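(* For every analytic set $E\subseteq\Pi$, $\mathbb{P}^{\mathrm{game}}(E)=\mathbb{P}^{\mathrm{meas}}(E)$.
   Context: Spaces. $\Omega:=\{0,1\}^{\infty}$ is the set of infinite binary sequences $(y_1,y_2,\ldots)$ and $\Omega^{\diamond}:=\bigcup_{n=0}^{\infty}\{0,1\}^n$ the set of finite binary sequences. $\Pi:=([0,1]\times\{0,1\})^{\infty}$ (the prequential space) is the set of infinite sequences $(p_1,y_1,p_2,y_2,\ldots)$ with $p_n\in[0,1]$, $y_n\in\{0,1\}$, and $\Pi^{\diamond}:=\bigcup_{n=0}^{\infty}([0,1]\times\{0,1\})^n$. $\Omega$ and $\Pi$ carry their product topologies (so $\Pi$ is a compact metrizable space). $\Lambda$ denotes the empty sequence. For $\pi=(p_1,y_1,p_2,y_2,\ldots)\in\Pi$ and $n\ge 0$, $\pi^n:=(p_1,y_1,\ldots,p_n,y_n)$. For $x\in\Omega^{\diamond}$, $\Gamma(x)\subseteq\Omega$ is the set of all infinite extensions of $x$ in $\Omega$. Game-theoretic probability. A farthingale is a function $V:\Pi^{\diamond}\to(-\infty,\infty]$ such that for all $x\in\Pi^{\diamond}$ and $p\in[0,1]$, $V(x)=(1-p)V(x,p,0)+pV(x,p,1)$, where $0\cdot\infty:=0$; no measurability is required. The upper game-theoretic probability of an arbitrary set $E\subseteq\Pi$ is $$\mathbb{P}^{\mathrm{game}}(E):=\inf\{a : \exists V:\ V(\Lambda)=a\text{ and }\forall\pi\in E:\ \limsup_{n\to\infty}V(\pi^n)\ge 1\},$$ where $V$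 ranges over the non-negative farthingales. Measure-theoretic probability. A forecasting system is a function $\phi:\Omega^{\diamond}\to[0,1]$. For each forecasting system $\phi$, $\mathbb{P}_{\phi}$ is the unique probability measure on the Borel $\sigma$-algebra of $\Omega$ with $\mathbb{P}_{\phi}(\Gamma(x1))=\phi(x)\,\mathbb{P}_{\phi}(\Gamma(x))$ for all $x\in\Omega^{\diamond}$, where $x1$ is $x$ followed by $1$; for an arbitrary set $A\subseteq\Omega$, $\mathbb{P}_{\phi}(A)$ denotes the outer measure $\inf_B\mathbb{P}_{\phi}(B)$, with $B$ ranging over the Borel sets containing $A$. For $\omega=(y_1,y_2,\ldots)\in\Omega$ put $\omega^{\phi}:=(\phi(\Lambda),y_1,\phi(y_1),y_2,\phi(y_1,y_2),y_3,\ldots)\in\Pi$. For $E\subseteq\Pi$ put $E^{\phi}:=\{\omega\in\Omega:\omega^{\phi}\in E\}$ and $\mathbb{P}^{\phi}(E):=\mathbb{P}_{\phi}(E^{\phi})$. The upper measure-theoretic probability of $E$ is $\mathbb{P}^{\mathrm{meas}}(E):=\sup_{\phi}\mathbb{P}^{\phi}(E)$, the supremum being over all forecasting systems $\phi$. *)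

theory Defs
  imports "HOL-Probability.Probability"
begin

text \<open>
  Infinite binary sequences are functions \<^typ>\<open>nat \<Rightarrow> bool\<close> (\<^const>\<open>True\<close> standing for 1) with the
  product topology of the type class instance, and finite ones are lists. Sequences are indexed
  from 0, so that \<open>\<omega> n\<close> and \<open>\<pi> n\<close> are the entries usually written with subscript \<open>n + 1\<close>.
\<close>

definition init_seg :: "(nat \<Rightarrow> 'a) \<Rightarrow> nat \<Rightarrow> 'a list" where
  "init_seg s n = map s [0..<n]"

definition prequential_topology :: "(nat \<Rightarrow> real \<times> bool) topology" where
  "prequential_topology =
     product_topology (\<lambda>_. prod_topology (top_of_set {0..1}) euclidean) UNIV"

definition prequential_space :: "(nat \<Rightarrow> real \<times> bool) set" where
  "prequential_space = {\<pi>. \<forall>n. fst (\<pi> n) \<in> {0..1}}"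

lemma topspace_prequential_topology: "topspace prequential_topology = prequential_space"
  by (auto simp: prequential_topology_def prequential_space_def PiE_UNIV_domain Pi_iff mem_Times_iff)

definition prequential_finite :: "(real \<times> bool) list set" where
  "prequential_finite = {x. \<forall>z\<in>set x. fst z \<in> {0..1}}"

text \<open>
  Analytic sets are the empty set and the continuous images of the Baire space. The type
  \<^typ>\<open>nat \<Rightarrow> nat\<close> carries the product of the discrete topologies.
\<close>

definition analytic_in :: "'a topology \<Rightarrow> 'a set \<Rightarrow> bool" where
  "analytic_in X A \<longleftrightarrow>
     A = {} \<or> (\<exists>f :: (nat \<Rightarrow> nat) \<Rightarrow> 'a. continuous_map euclidean X f \<and> range f = A)"

text \<open>
  In \<^typ>\<open>ereal\<close> one has \<open>0 * \<infinity> = 0\<close>. Values of a farthingale outside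
  \<^const>\<open>prequential_finite\<close> are irrelevant and left unconstrained.
\<close>

definition farthingale :: "((real \<times> bool) list \<Rightarrow> ereal) \<Rightarrow> bool" where
  "farthingale V \<longleftrightarrow>
     (\<forall>x\<in>prequential_finite. V x \<noteq> -\<infinity>) \<and>
     (\<forall>x\<in>prequential_finite. \<forall>p\<in>{0..1}.
        V x = ereal (1 - p) * V (x @ [(p, False)]) + ereal p * V (x @ [(p, True)]))"

definition upper_game_prob :: "(nat \<Rightarrow> real \<times> bool) set \<Rightarrow> ereal" where
  "upper_game_prob E =
     Inf {a. \<exists>V. farthingale V \<and> (\<forall>x\<in>prequential_finite. 0 \<le> V x) \<and> V [] = a \<and>
               (\<forall>\<pi>\<in>E. limsup (\<lambda>n. V (init_seg \<pi> n)) \<ge> 1)}"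

definition forecasting_system :: "(bool list \<Rightarrow> real) \<Rightarrow> bool" where
  "forecasting_system \<phi> \<longleftrightarrow> (\<forall>x. \<phi> x \<in> {0..1})"

definition extensions :: "bool list \<Rightarrow> (nat \<Rightarrow> bool) set" where
  "extensions x = {\<omega>. init_seg \<omega> (length x) = x}"

text \<open>
  The description determines a unique measure whenever \<open>\<phi>\<close> is a forecasting system.
\<close>

definition forecast_measure :: "(bool list \<Rightarrow> real) \<Rightarrow> (nat \<Rightarrow> bool) measure" where
  "forecast_measure \<phi> =
     (THE M. prob_space M \<and> sets M = sets borel \<and>
             (\<forall>x. measure M (extensions (x @ [True])) = \<phi> x * measure M (extensions x)))"

definition forecast_path :: "(bool list \<Rightarrow> real) \<Rightarrow> (nat \<Rightarrow> bool) \<Rightarrow> (nat \<Rightarrow> real \<times> bool)" where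
  "forecast_path \<phi> \<omega> = (\<lambda>n. (\<phi> (init_seg \<omega> n), \<omega> n))"

definition upper_meas_prob :: "(nat \<Rightarrow> real \<times> bool) set \<Rightarrow> ereal" where
  "upper_meas_prob E =
     (SUP \<phi>\<in>{\<phi>. forecasting_system \<phi>}.
        enn2ereal (outer_measure_of (forecast_measure \<phi>) {\<omega>. forecast_path \<phi> \<omega> \<in> E}))"

end

theory Submission
  imports Defs
begin

text \<open>
  Game-theoretic and measure-theoretic probability agree on analytic sets because the game-theoretic one is a
  capacity for which finite horizons can be analysed by backward induction.

  It is convenient to compute the game-theoretic probability with superfarthingales that have to get to 1 once
  (\<open>upper_game_prob_eq_game\<close>): stopping turns one good moment into a limit, and money thrown away can be kept.
  Along the path of a forecasting system such a superfarthingale is a supermartingale, so Ville's inequality shows that the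
  measure-theoretic probability is at most the game-theoretic one (\<open>outer_measure_le_game\<close>), for every set.

  The reverse inequality needs, for each \<open>c\<close> below the game value of \<open>E\<close>, a single forecasting system under which \<open>E\<close>
  has outer probability at least \<open>c\<close>. Three facts combine.

  \<^item> For a condition on the first \<open>n\<close> moves, backward induction produces near-optimal forecasting systems
    (\<open>game_le_SUP_forecast_expect\<close>).

  \<^item> The game value is continuous along increasing sequences of arbitrary sets (\<open>game_incseq_le\<close>). The reason is a
    zero-one law: if all conditional values of a set are at most \<open>t < 1\<close>, the gambler can begin again whenever
    a target is met, so the value is at most \<open>t\<close> times itself and vanishes (\<open>game_zero_one\<close>).

  \<^item> Forecasting systems form a compact space, and probabilities of cylinders depend continuously on the system
    (\<open>tendsto_forecast_expect\<close>).

  For \<open>E = range f\<close> with \<open>f\<close> continuous on the Baire space, continuity from below yields, as in Choquet's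
  capacitability theorem, bounds on the coordinates of the argument that cost no more than the distance to \<open>c\<close>. The
  systems belonging to the horizons \<open>k = 0, 1, ...\<close> have a limit point, and compactness of the bounded arguments shows
  that this limit system does what is wanted (\<open>game_analytic_attained\<close>).
\<close>

section \<open>Initial segments and tails\<close>

lemma init_seg_0 [simp]: "init_seg s 0 = []"
  by (simp add: init_seg_def)

lemma length_init_seg [simp]: "length (init_seg s n) = n"
  by (simp add: init_seg_def)

lemma init_seg_Suc: "init_seg s (Suc n) = init_seg s n @ [s n]"
  by (simp add: init_seg_def)

lemma init_seg_case_nat [simp]: "init_seg (case_nat z s) (Suc n) = z # init_seg s n"
  by (induction n) (simp_all add: init_seg_Suc)

lemma take_init_seg: "k \<le> n \<Longrightarrow> take k (init_seg s n) = init_seg s k"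
  by (simp add: init_seg_def take_map)

text \<open>
  The set that remains to be covered once the moves \<open>x\<close> have been made. With it a game that is under
  way is again a game from the start, so that conditional upper probabilities need no notion of their own.
\<close>
primrec after :: "'a list \<Rightarrow> (nat \<Rightarrow> 'a) set \<Rightarrow> (nat \<Rightarrow> 'a) set" where
  "after [] E = E"
| "after (z # x) E = after x {\<rho>. case_nat z \<rho> \<in> E}"

lemma after_append [simp]: "after (x @ y) E = after y (after x E)"
  by (induction x arbitrary: E) auto

lemma after_mono: "E \<subseteq> F \<Longrightarrow> after x E \<subseteq> after x F"
proof (induction x arbitrary: E F)
  case (Cons z x)
  have "{\<rho>. case_nat z \<rho> \<in> E} \<subseteq> {\<rho>. case_nat z \<rho> \<in> F}" using Cons.prems by blast
  then show ?case unfolding after.simps by (rule Cons.IH)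
qed simp

lemma shift_in_after: "\<pi> \<in> E \<Longrightarrow> (\<lambda>k. \<pi> (k + n)) \<in> after (init_seg \<pi> n) E"
proof (induction n)
  case (Suc n)
  have "case_nat (\<pi> n) (\<lambda>k. \<pi> (k + Suc n)) = (\<lambda>k. \<pi> (k + n))"
    by (auto split: nat.split)
  with Suc show ?case by (simp add: init_seg_Suc)
qed simp

lemma in_afterD:
  assumes "\<rho> \<in> after x E"
  obtains \<pi> where "\<pi> \<in> E" "\<And>n. init_seg \<pi> (length x + n) = x @ init_seg \<rho> n"
  using assms
proof (induction x arbitrary: E thesis)
  case Nil
  then show ?case by auto
next
  case (Cons z x)
  from Cons.prems(2) have "\<rho> \<in> after x {\<rho>. case_nat z \<rho> \<in> E}" by simp
  from Cons.IH[OF _ this] obtain \<pi> where *: "case_nat z \<pi> \<in> E" "\<And>n. init_seg \<pi> (length x + n) = x @ init_seg \<rho> n"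
    by auto
  show ?case
    by (rule Cons.prems(1)[OF *(1)]) (simp add: *(2))
qed

section \<open>Two-point averages of extended non-negative reals\<close>

definition mix :: "real \<Rightarrow> ennreal \<Rightarrow> ennreal \<Rightarrow> ennreal" where
  "mix p a b = ennreal (1 - p) * a + ennreal p * b"

lemma mix_mono: "a \<le> a' \<Longrightarrow> b \<le> b' \<Longrightarrow> mix p a b \<le> mix p a' b'"
  unfolding mix_def by (intro add_mono mult_left_mono) auto

lemma mix_same [simp]: "p \<in> {0..1} \<Longrightarrow> mix p c c = c"
  unfolding mix_def by (simp flip: distrib_right ennreal_plus)

lemma mix_add: "mix p (a + c) (b + d) = mix p a b + mix p c d"
  unfolding mix_def by (simp only: distrib_left add.assoc add.left_commute)

lemma mix_cmult: "mix p (c * a) (c * b) = c * mix p a b"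
  unfolding mix_def by (simp add: distrib_left ac_simps)

lemma mix_suminf: "mix p (\<Sum>i. f i) (\<Sum>i. g i) = (\<Sum>i. mix p (f i) (g i))"
  unfolding mix_def ennreal_suminf_cmult[symmetric] by (intro suminf_add) auto

lemma mix_SUP:
  assumes "incseq f" "incseq g"
  shows "mix p (SUP i. f i) (SUP i. g i) = (SUP i. mix p (f i) (g i))"
proof -
  have "incseq (\<lambda>i. ennreal (1 - p) * f i)" "incseq (\<lambda>i. ennreal p * g i)"
    using assms by (auto simp: incseq_def intro!: mult_left_mono)
  then show ?thesis
    unfolding mix_def by (simp add: SUP_mult_left_ennreal ennreal_SUP_add)
qed

text \<open>
  Limits through thresholds below 1 are taken in this form: a capital that gets to \<open>1 / s\<close> becomes one
  that gets to 1 after multiplication with \<open>s\<close>, and then \<open>s\<close> tends to 1.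
\<close>
lemma ennreal_le_of_le_mult:
  fixes x y :: ennreal
  assumes "\<And>s::real. 1 < s \<Longrightarrow> x \<le> ennreal s * y"
  shows "x \<le> y"
proof (cases y)
  case (real r)
  show ?thesis
  proof (rule ennreal_le_epsilon)
    fix e :: real assume "0 < e"
    define s where "s = 1 + e / (r + 1)"
    have "1 < s" using \<open>0 < e\<close> real by (simp add: s_def)
    have "s * r \<le> r + e"
      using \<open>0 < e\<close> real by (simp add: s_def field_simps)
    have "x \<le> ennreal s * y" using \<open>1 < s\<close> by (rule assms)
    also have "\<dots> = ennreal (s * r)" using real \<open>1 < s\<close> by (simp add: ennreal_mult)
    also have "\<dots> \<le> y + ennreal e"
      using \<open>s * r \<le> r + e\<close> real \<open>0 < e\<close> by (simp flip: ennreal_plus)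
    finally show "x \<le> y + ennreal e" .
  qed
qed simp

section \<open>The value of the covering game\<close>

text \<open>
  A gambler who may throw money away. Stopping and the passage to the best strategy at every
  position lead to superfarthingales, rarely to farthingales. The inequality is asked of every list,
  including lists with moves outside \<open>[0, 1]\<close>, so that passing to a subtree preserves the property.
\<close>
definition superfarthingale :: "((real \<times> bool) list \<Rightarrow> ennreal) \<Rightarrow> bool" where
  "superfarthingale S \<longleftrightarrow>
     (\<forall>x. \<forall>p\<in>{0..1}. mix p (S (x @ [(p, False)])) (S (x @ [(p, True)])) \<le> S x)"

definition reaches :: "((real \<times> bool) list \<Rightarrow> ennreal) \<Rightarrow> (nat \<Rightarrow> real \<times> bool) set \<Rightarrow> bool" where
  "reaches S E \<longleftrightarrow> (\<forall>\<pi>\<in>E. \<exists>n. 1 \<le> S (init_seg \<pi> n))"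

lemma reachesE:
  assumes "reaches S E" "\<pi> \<in> E"
  obtains n where "1 \<le> S (init_seg \<pi> n)"
  using assms by (auto simp: reaches_def)

text \<open>
  This differs from \<^const>\<open>upper_game_prob\<close> in two ways that do not change the value
  (\<open>upper_game_prob_eq_game\<close>): money may be thrown away, and the capital has to get to 1 once
  instead of having upper limit at least 1.
\<close>
definition game_value :: "(nat \<Rightarrow> real \<times> bool) set \<Rightarrow> ennreal" where
  "game_value E = (INF S\<in>{S. superfarthingale S \<and> reaches S E}. S [])"

lemma superfarthingaleD:
  "superfarthingale S \<Longrightarrow> p \<in> {0..1} \<Longrightarrow> mix p (S (x @ [(p, False)])) (S (x @ [(p, True)])) \<le> S x"
  by (simp add: superfarthingale_def)

lemma superfarthingale_const: "superfarthingale (\<lambda>_. c)"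
  by (simp add: superfarthingale_def)

lemma superfarthingale_add:
  "superfarthingale S \<Longrightarrow> superfarthingale U \<Longrightarrow> superfarthingale (\<lambda>x. S x + U x)"
  by (simp add: superfarthingale_def mix_add add_mono)

lemma superfarthingale_cmult:
  "superfarthingale S \<Longrightarrow> superfarthingale (\<lambda>x. c * S x)"
  by (simp add: superfarthingale_def mix_cmult mult_left_mono)

lemma superfarthingale_suminf:
  "(\<And>i. superfarthingale (S i)) \<Longrightarrow> superfarthingale (\<lambda>x. \<Sum>i. S i x)"
  by (simp add: superfarthingale_def mix_suminf suminf_le)

lemma superfarthingale_shift:
  "superfarthingale S \<Longrightarrow> superfarthingale (\<lambda>y. S (x @ y))"
  unfolding superfarthingale_def by (metis append_assoc)

lemma game_le: "superfarthingale S \<Longrightarrow> reaches S E \<Longrightarrow> game_value E \<le> S []"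
  unfolding game_value_def by (intro INF_lower2[of S]) auto

lemma game_greatest:
  "(\<And>S. superfarthingale S \<Longrightarrow> reaches S E \<Longrightarrow> c \<le> S []) \<Longrightarrow> c \<le> game_value E"
  unfolding game_value_def by (intro INF_greatest) auto

lemma game_lessD:
  assumes "game_value E < c"
  obtains S where "superfarthingale S" "reaches S E" "S [] < c"
  using assms unfolding game_value_def by (auto simp: INF_less_iff)

lemma game_le_1: "game_value E \<le> 1"
  by (rule game_le[OF superfarthingale_const]) (auto simp: reaches_def)

lemma game_finite: "game_value E < \<top>"
  using game_le_1[of E] by (rule le_less_trans) simp

lemma game_empty [simp]: "game_value {} = 0"
proof -
  have "game_value {} \<le> 0"
    by (rule game_le[OF superfarthingale_const]) (auto simp: reaches_def)
  then show ?thesis by simp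
qed

lemma game_mono: "E \<subseteq> F \<Longrightarrow> game_value E \<le> game_value F"
  by (rule game_greatest, rule game_le) (auto simp: reaches_def)

lemma game_near:
  assumes "0 < e"
  obtains S where "superfarthingale S" "reaches S E" "S [] < game_value E + e"
proof -
  have "game_value E < game_value E + e"
    using game_finite[of E] assms ennreal_add_left_cancel_less[of "game_value E" 0 e] by auto
  then show thesis using that by (rule game_lessD)
qed

text \<open>
  Stakes \<open>e / 2, e / 4, ...\<close> beyond the optimal ones are spent on the separate strategies, and
  the strategies are run side by side; values in \<^typ>\<open>ennreal\<close> make the infinite sum harmless.
\<close>
lemma game_UN_le: "game_value (\<Union>i::nat. E i) \<le> (\<Sum>i. game_value (E i))"
proof (rule ennreal_le_epsilon)
  fix e :: real assume "0 < e"
  have "\<exists>S. superfarthingale S \<and> reaches S (E i) \<and> S [] \<le> game_value (E i) + ennreal (e * (1/2) ^ Suc i)" for i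
  proof -
    have "0 < ennreal (e * (1/2) ^ Suc i)" using \<open>0 < e\<close> by simp
    then obtain S where "superfarthingale S" "reaches S (E i)"
        "S [] < game_value (E i) + ennreal (e * (1/2) ^ Suc i)"
      by (rule game_near)
    then show ?thesis by (intro exI[of _ S]) auto
  qed
  then obtain S where S: "\<And>i. superfarthingale (S i)" "\<And>i. reaches (S i) (E i)"
      "\<And>i. S i [] \<le> game_value (E i) + ennreal (e * (1/2) ^ Suc i)"
    by metis
  have "reaches (\<lambda>x. \<Sum>i. S i x) (\<Union>i. E i)"
    unfolding reaches_def
  proof
    fix \<pi> assume "\<pi> \<in> (\<Union>i. E i)"
    then obtain i where "\<pi> \<in> E i" by auto
    with S(2)[of i] obtain n where "1 \<le> S i (init_seg \<pi> n)" by (rule reachesE)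
    also have "\<dots> \<le> (\<Sum>i. S i (init_seg \<pi> n))"
      using sum_le_suminf[of "\<lambda>i. S i (init_seg \<pi> n)" "{i}"] by simp
    finally show "\<exists>n. 1 \<le> (\<Sum>i. S i (init_seg \<pi> n))" ..
  qed
  then have "game_value (\<Union>i. E i) \<le> (\<Sum>i. S i [])"
    using S(1) by (intro game_le superfarthingale_suminf)
  also have "\<dots> \<le> (\<Sum>i. game_value (E i) + ennreal (e * (1/2) ^ Suc i))"
    by (intro suminf_le S) auto
  also have "\<dots> = (\<Sum>i. game_value (E i)) + (\<Sum>i. ennreal (e * (1/2) ^ Suc i))"
    by (intro suminf_add[symmetric]) auto
  also have "(\<Sum>i. ennreal (e * (1/2) ^ Suc i)) = ennreal e"
    using sums_mult[OF power_half_series, of e] \<open>0 < e\<close> by (intro suminf_ennreal_eq) auto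
  finally show "game_value (\<Union>i. E i) \<le> (\<Sum>i. game_value (E i)) + ennreal e" .
qed

text \<open>
  A strategy for \<open>after x E\<close> continues as a strategy for each of the sets that can arise one move
  later, unless it has already reached 1 at \<open>x\<close>; in that case its capital is at least 1, an upper bound for every mean of game values.
\<close>
lemma superfarthingale_game_after: "superfarthingale (\<lambda>x. game_value (after x E))"
  unfolding superfarthingale_def
proof (intro allI ballI)
  fix x and p :: real assume p: "p \<in> {0..1}"
  let ?E = "after x E"
  show "mix p (game_value (after (x @ [(p, False)]) E)) (game_value (after (x @ [(p, True)]) E)) \<le> game_value ?E"
  proof (rule game_greatest)
    fix S assume S: "superfarthingale S" "reaches S ?E"
    show "mix p (game_value (after (x @ [(p, False)]) E)) (game_value (after (x @ [(p, True)]) E)) \<le> S []"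
    proof (cases "1 \<le> S []")
      case True
      have "mix p (game_value (after (x @ [(p, False)]) E)) (game_value (after (x @ [(p, True)]) E)) \<le> mix p 1 1"
        by (intro mix_mono game_le_1)
      with True p show ?thesis by simp
    next
      case False
      have "game_value (after (x @ [z]) E) \<le> S [z]" for z
      proof -
        have "reaches (\<lambda>y. S ([z] @ y)) (after (x @ [z]) E)"
          unfolding reaches_def
        proof
          fix \<rho> assume "\<rho> \<in> after (x @ [z]) E"
          then have "case_nat z \<rho> \<in> ?E" by simp
          then obtain n where n: "1 \<le> S (init_seg (case_nat z \<rho>) n)" 
            using S(2) by (auto simp: reaches_def)
          then obtain m where "n = Suc m" using False by (cases n) auto
          with n show "\<exists>n. 1 \<le> S ([z] @ init_seg \<rho> n)" by auto
        qed
        from game_le[OF superfarthingale_shift[OF S(1)] this] show ?thesis by simp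
      qed
      then have "mix p (game_value (after (x @ [(p, False)]) E)) (game_value (after (x @ [(p, True)]) E))
          \<le> mix p (S ([] @ [(p, False)])) (S ([] @ [(p, True)]))"
        by (intro mix_mono) simp_all
      also have "\<dots> \<le> S []" using S(1) p by (rule superfarthingaleD)
      finally show ?thesis .
    qed
  qed
qed

text \<open>
  The converse of \<open>superfarthingale_game_after\<close>: near-optimal strategies for all the positions after the
  first move are glued together, which is possible because a strategy may depend on the forecast \<open>p\<close> in an arbitrary way.
  The supremum is what the gambler needs against the worst first forecast.
\<close>
lemma game_le_SUP_mix:
  "game_value E \<le> (SUP p\<in>{0..1}. mix p (game_value (after [(p, False)] E)) (game_value (after [(p, True)] E)))"
    (is "_ \<le> ?B")
proof (rule ennreal_le_epsilon)
  fix e :: real assume "0 < e"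
  have "\<exists>S. superfarthingale S \<and> reaches S (after [z] E) \<and> S [] \<le> game_value (after [z] E) + e" for z
  proof -
    have "0 < ennreal e" using \<open>0 < e\<close> by simp
    then obtain S where "superfarthingale S" "reaches S (after [z] E)"
        "S [] < game_value (after [z] E) + ennreal e"
      by (rule game_near)
    then show ?thesis by (intro exI[of _ S]) auto
  qed
  then obtain S where S: "\<And>z. superfarthingale (S z)" "\<And>z. reaches (S z) (after [z] E)"
      "\<And>z. S z [] \<le> game_value (after [z] E) + e"
    by metis
  define U where "U x = (case x of [] \<Rightarrow> ?B + e | z # y \<Rightarrow> S z y)" for x
  have "superfarthingale U"
    unfolding superfarthingale_def
  proof (intro allI ballI)
    fix x and p :: real assume p: "p \<in> {0..1}"
    show "mix p (U (x @ [(p, False)])) (U (x @ [(p, True)])) \<le> U x"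
    proof (cases x)
      case Nil
      have "mix p (U [(p, False)]) (U [(p, True)])
          \<le> mix p (game_value (after [(p, False)] E) + e) (game_value (after [(p, True)] E) + e)"
        unfolding U_def list.case by (intro mix_mono S)
      also have "\<dots> = mix p (game_value (after [(p, False)] E)) (game_value (after [(p, True)] E)) + e"
        using p by (simp add: mix_add)
      also have "\<dots> \<le> ?B + e"
        using p by (intro add_mono SUP_upper) auto
      finally show ?thesis using Nil by (simp add: U_def)
    next
      case (Cons z y)
      then show ?thesis using superfarthingaleD[OF S(1) p] by (simp add: U_def)
    qed
  qed
  moreover have "reaches U E"
    unfolding reaches_def
  proof
    fix \<pi> assume "\<pi> \<in> E"
    moreover have "\<pi> = case_nat (\<pi> 0) (\<lambda>k. \<pi> (Suc k))" by (auto split: nat.split)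
    ultimately have "(\<lambda>k. \<pi> (Suc k)) \<in> after [\<pi> 0] E" by simp
    with S(2) obtain n where "1 \<le> S (\<pi> 0) (init_seg (\<lambda>k. \<pi> (Suc k)) n)" 
      by (rule reachesE)
    then have "1 \<le> U (init_seg \<pi> (Suc n))"
      by (subst \<open>\<pi> = _\<close>) (simp add: U_def)
    then show "\<exists>n. 1 \<le> U (init_seg \<pi> n)" ..
  qed
  ultimately have "game_value E \<le> U []" by (rule game_le)
  then show "game_value E \<le> ?B + e" by (simp add: U_def)
qed

section \<open>Stopping, restarting and a zero-one law\<close>

definition has_reached :: "((real \<times> bool) list \<Rightarrow> ennreal) \<Rightarrow> (real \<times> bool) list \<Rightarrow> bool" where
  "has_reached S x \<longleftrightarrow> (\<exists>k\<le>length x. 1 \<le> S (take k x))"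

lemma has_reached_snoc: "has_reached S (x @ [z]) \<longleftrightarrow> has_reached S x \<or> 1 \<le> S (x @ [z])"
  by (auto simp: has_reached_def le_Suc_eq)

lemma has_reached_append: "has_reached S x \<Longrightarrow> has_reached S (x @ y)"
  by (induction y rule: rev_induct) (simp_all add: has_reached_snoc flip: append_assoc)

text \<open>
  The excess over 1 at the stopping time is thrown away, which makes the stopped capital bounded by 1.
\<close>
definition stopped :: "((real \<times> bool) list \<Rightarrow> ennreal) \<Rightarrow> (real \<times> bool) list \<Rightarrow> ennreal" where
  "stopped S x = (if has_reached S x then 1 else S x)"

lemma stopped_Nil_le: "stopped S [] \<le> S []"
  by (auto simp: stopped_def has_reached_def)

lemma stopped_le_1: "stopped S x \<le> 1"
  by (auto simp: stopped_def has_reached_def)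

lemma stopped_eq_1:
  assumes "1 \<le> S (init_seg \<pi> n)" "n \<le> m"
  shows "stopped S (init_seg \<pi> m) = 1"
proof -
  have "has_reached S (init_seg \<pi> m)"
    unfolding has_reached_def using assms by (intro exI[of _ n]) (simp add: take_init_seg)
  then show ?thesis by (simp add: stopped_def)
qed

lemma superfarthingale_stopped:
  assumes "superfarthingale S"
  shows "superfarthingale (stopped S)"
  unfolding superfarthingale_def
proof (intro allI ballI)
  fix x and p :: real assume p: "p \<in> {0..1}"
  show "mix p (stopped S (x @ [(p, False)])) (stopped S (x @ [(p, True)])) \<le> stopped S x"
  proof (cases "has_reached S x")
    case True
    then show ?thesis using p by (simp add: stopped_def has_reached_snoc)
  next
    case False
    then have "stopped S (x @ [z]) \<le> S (x @ [z])" for z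
      by (auto simp: stopped_def has_reached_snoc)
    then have "mix p (stopped S (x @ [(p, False)])) (stopped S (x @ [(p, True)]))
       \<le> mix p (S (x @ [(p, False)])) (S (x @ [(p, True)]))"
      by (intro mix_mono)
    also have "\<dots> \<le> S x" using assms p by (rule superfarthingaleD)
    finally show ?thesis using False by (simp add: stopped_def)
  qed
qed

text \<open>
  A two-stage strategy: stake \<open>t\<close> times the strategy \<open>S\<close>. When \<open>S\<close> first gets to 1, say at \<open>x\<close>, the
  capital is at least \<open>t\<close>, enough to start afresh on what then remains of \<open>E\<close>.
\<close>
lemma game_le_mult:
  assumes S: "superfarthingale S" "reaches S E" and t: "\<And>x. game_value (after x E) < t"
  shows "game_value E \<le> t * S []"
proof -
  have "\<exists>U. superfarthingale U \<and> reaches U (after x E) \<and> U [] \<le> t" for x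
  proof -
    from t obtain U where "superfarthingale U" "reaches U (after x E)" "U [] < t"
      by (rule game_lessD)
    then show ?thesis by (intro exI[of _ U]) auto
  qed
  then obtain U where U: "\<And>x. superfarthingale (U x)" "\<And>x. reaches (U x) (after x E)"
      "\<And>x. U x [] \<le> t"
    by metis
  \<comment> \<open>The time at which the first stage ends, and the combined capital.\<close>
  define k where "k x = (LEAST k. 1 \<le> S (take k x))" for x
  define C where "C x = (if has_reached S x then U (take (k x) x) (drop (k x) x) else t * S x)" for x
  have k_le: "k x \<le> length x" if "has_reached S x" for x
    using that unfolding has_reached_def k_def by (meson Least_le le_trans)
  have k_append: "k (x @ y) = k x" if "has_reached S x" for x y
    unfolding k_def
  proof (rule Least_equality)
    from that have "1 \<le> S (take (LEAST k. 1 \<le> S (take k x)) x)"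
      unfolding has_reached_def by (metis (mono_tags, lifting) LeastI)
    with k_le[OF that] show "1 \<le> S (take (LEAST k. 1 \<le> S (take k x)) (x @ y))"
      by (simp add: k_def)
  next
    fix j assume "1 \<le> S (take j (x @ y))"
    then show "(LEAST k. 1 \<le> S (take k x)) \<le> j"
      using k_le[OF that] by (cases "j \<le> length x") (auto simp: k_def intro: Least_le)
  qed
  have k_eq: "k x = length x" if "has_reached S x" "\<And>j. j < length x \<Longrightarrow> \<not> 1 \<le> S (take j x)" for x
  proof (rule antisym[OF k_le[OF that(1)]], rule leI, rule notI)
    assume "k x < length x"
    moreover from that(1) have "1 \<le> S (take (k x) x)"
      unfolding has_reached_def k_def by (metis (mono_tags, lifting) LeastI)
    ultimately show False using that(2) by blast
  qed
  \<comment> \<open>This covers both a first stage still running and one that ends exactly at \<open>x\<close>.\<close>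
  have C_new: "C x \<le> t * S x" if "\<And>j. j < length x \<Longrightarrow> \<not> 1 \<le> S (take j x)" for x
  proof (cases "has_reached S x")
    case True
    then have "1 \<le> S x" using that by (auto simp: has_reached_def le_less)
    have "C x = U x []" using True k_eq[OF True that] by (simp add: C_def)
    also have "\<dots> \<le> t * 1" using U(3) by simp
    also have "\<dots> \<le> t * S x" using \<open>1 \<le> S x\<close> by (intro mult_left_mono) auto
    finally show ?thesis .
  qed (simp add: C_def)
  have "superfarthingale C"
    unfolding superfarthingale_def
  proof (intro allI ballI)
    fix x and p :: real assume p: "p \<in> {0..1}"
    show "mix p (C (x @ [(p, False)])) (C (x @ [(p, True)])) \<le> C x"
    proof (cases "has_reached S x")
      case True
      then show ?thesis
        using superfarthingaleD[OF U(1) p, of "take (k x) x" "drop (k x) x"] k_le[OF True]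
        by (simp add: C_def has_reached_snoc k_append)
    next
      case False
      have "C (x @ [z]) \<le> t * S (x @ [z])" for z
        using False by (intro C_new) (auto simp: has_reached_def)
      then have "mix p (C (x @ [(p, False)])) (C (x @ [(p, True)]))
        \<le> mix p (t * S (x @ [(p, False)])) (t * S (x @ [(p, True)]))"
        by (intro mix_mono)
      also have "\<dots> \<le> t * S x"
        unfolding mix_cmult using S(1) p by (intro mult_left_mono superfarthingaleD) auto
      finally show ?thesis using False by (simp add: C_def)
    qed
  qed
  moreover have "reaches C E"
    unfolding reaches_def
  proof
    fix \<pi> assume \<pi>: "\<pi> \<in> E"
    then obtain n where n: "1 \<le> S (init_seg \<pi> n)" using S(2) by (auto simp: reaches_def)
    then have hr: "has_reached S (init_seg \<pi> n)"
      unfolding has_reached_def by (intro exI[of _ n]) simp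
    define j where j_def: "j = k (init_seg \<pi> n)"
    have "j \<le> n" using k_le[OF hr] by (simp add: j_def)
    define \<rho> where "\<rho> = (\<lambda>i. \<pi> (i + j))"
    have "\<rho> \<in> after (init_seg \<pi> j) E" unfolding \<rho>_def using \<pi> by (rule shift_in_after)
    then obtain i where i: "1 \<le> U (init_seg \<pi> j) (init_seg \<rho> i)"
      using U(2) by (auto simp: reaches_def)
    have seg: "init_seg \<pi> (j + l) = init_seg \<pi> j @ init_seg \<rho> l" for l
      by (induction l) (simp_all add: init_seg_Suc \<rho>_def add.commute)
    have hrj: "has_reached S (init_seg \<pi> j)"
    proof -
      have "1 \<le> S (take j (init_seg \<pi> n))"
        unfolding j_def k_def
        by (rule LeastI[of "\<lambda>k. 1 \<le> S (take k (init_seg \<pi> n))" n])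
          (simp add: take_init_seg n)
      then have "1 \<le> S (take j (init_seg \<pi> j))" using \<open>j \<le> n\<close> by (simp add: take_init_seg)
      then show ?thesis unfolding has_reached_def by (intro exI[of _ j]) simp
    qed
    have "k (init_seg \<pi> j) = j"
    proof -
      have "init_seg \<pi> n = init_seg \<pi> j @ init_seg \<rho> (n - j)" using seg[of "n - j"] \<open>j \<le> n\<close> by simp
      then show ?thesis using k_append[OF hrj] unfolding j_def by metis
    qed
    then have "k (init_seg \<pi> (j + i)) = j" using k_append[OF hrj] by (simp add: seg)
    moreover have "has_reached S (init_seg \<pi> (j + i))"
      unfolding seg by (rule has_reached_append[OF hrj])
    ultimately have "1 \<le> C (init_seg \<pi> (j + i))" using i by (simp add: C_def seg)
    then show "\<exists>n. 1 \<le> C (init_seg \<pi> n)" ..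
  qed
  ultimately have "game_value E \<le> C []" by (rule game_le)
  also have "\<dots> \<le> t * S []" by (rule C_new) simp
  finally show ?thesis .
qed

text \<open>
  By restarting, the value of \<open>E\<close> is at most \<open>s\<close> times itself for every \<open>s > t\<close>; a finite number with this
  property for some \<open>s < 1\<close> vanishes.
\<close>
lemma game_zero_one:
  assumes le: "\<And>x. game_value (after x E) \<le> t" and "t < 1"
  shows "game_value E = 0"
proof (rule ccontr)
  assume "game_value E \<noteq> 0"
  obtain s where s: "t < s" "s < 1" using dense[OF \<open>t < 1\<close>] by blast
  then have "0 < s" by (metis le_less_trans zero_le)
  have "game_value E / s \<le> game_value E"
  proof (rule game_greatest)
    fix S assume "superfarthingale S" "reaches S E"
    then have "game_value E \<le> s * S []"
      using le s(1) by (intro game_le_mult) (auto intro: le_less_trans)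
    then show "game_value E / s \<le> S []"
      using \<open>0 < s\<close> by (intro divide_le_posI_ennreal)
  qed
  then have "game_value E \<le> s * game_value E"
  proof -
    assume *: "game_value E / s \<le> game_value E"
    have "game_value E = s * (game_value E / s)"
    proof -
      have "s \<noteq> 0" "s \<noteq> \<top>" using \<open>0 < s\<close> s(2) by auto
      then show ?thesis
        by (simp add: ennreal_times_divide mult.commute[of s] mult_divide_eq_ennreal)
    qed
    also have "\<dots> \<le> s * game_value E" using * by (intro mult_left_mono) auto
    finally show ?thesis .
  qed
  also have "s * game_value E < 1 * game_value E"
    using s(2) \<open>game_value E \<noteq> 0\<close> game_finite[of E]
    by (intro ennreal_mult_strict_right_mono) (auto simp: zero_less_iff_neq_zero)
  finally show False by simp
qed

section \<open>Continuity from below\<close>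

text \<open>
  Put \<open>W x = (SUP i. game_value (after x (E i)))\<close>, a superfarthingale that starts with the right capital. It need not
  reach 1 on the union, but fix \<open>a < 1\<close>: the paths of \<open>E i\<close> on which the conditional value of \<open>E i\<close> never exceeds \<open>a\<close> form a
  set all of whose conditional values are at most \<open>a\<close>, hence a null set by the zero-one law. Outside these countably many
  null sets, \<open>W / a\<close> gets to 1. This is a game-theoretic form of Levy's zero-one law.
\<close>
lemma game_incseq_le:
  assumes "incseq E"
  shows "game_value (\<Union>i. E i) \<le> (SUP i. game_value (E i))"
proof -
  let ?c = "SUP i. game_value (E i)"
  show ?thesis
  proof (rule ennreal_le_of_le_mult)
    fix s :: real assume "1 < s"
    define a where "a = ennreal (1 / s)"
    have "a < 1" using \<open>1 < s\<close> by (simp add: a_def)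
    have sa: "ennreal s * a = 1" using \<open>1 < s\<close> by (simp add: a_def flip: ennreal_mult)
    define H where "H i = {\<pi>\<in>E i. \<forall>k. game_value (after (init_seg \<pi> k) (E i)) \<le> a}" for i
    have H0: "game_value (H i) = 0" for i
    proof (rule game_zero_one[OF _ \<open>a < 1\<close>])
      fix x
      show "game_value (after x (H i)) \<le> a"
      proof (cases "after x (H i) = {}")
        case False
        then obtain \<rho> \<pi> where "\<pi> \<in> H i" "\<And>n. init_seg \<pi> (length x + n) = x @ init_seg \<rho> n"
          by (metis all_not_in_conv in_afterD)
        then have "init_seg \<pi> (length x) = x" by (metis add.right_neutral append_Nil2 init_seg_0)
        with \<open>\<pi> \<in> H i\<close> have "game_value (after x (E i)) \<le> a"
          unfolding H_def by (metis (mono_tags, lifting) mem_Collect_eq)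
        moreover have "game_value (after x (H i)) \<le> game_value (after x (E i))"
          by (intro game_mono after_mono) (auto simp: H_def)
        ultimately show ?thesis by simp
      qed simp
    qed
    have N: "game_value (\<Union>i. H i) = 0" using game_UN_le[of H] by (simp add: H0)
    define W where "W x = (SUP i. game_value (after x (E i)))" for x
    have W: "superfarthingale W"
      unfolding superfarthingale_def W_def
    proof (intro allI ballI)
      fix x and p :: real assume p: "p \<in> {0..1}"
      have "incseq (\<lambda>i. game_value (after y (E i)))" for y
        using assms by (auto simp: incseq_def intro!: game_mono after_mono)
      then have "mix p (SUP i. game_value (after (x @ [(p, False)]) (E i)))
            (SUP i. game_value (after (x @ [(p, True)]) (E i)))
          = (SUP i. mix p (game_value (after (x @ [(p, False)]) (E i)))
              (game_value (after (x @ [(p, True)]) (E i))))"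
        by (intro mix_SUP)
      also have "\<dots> \<le> (SUP i. game_value (after x (E i)))"
        by (intro SUP_mono' superfarthingaleD[OF superfarthingale_game_after p])
      finally show "mix p (SUP i. game_value (after (x @ [(p, False)]) (E i)))
          (SUP i. game_value (after (x @ [(p, True)]) (E i))) \<le> (SUP i. game_value (after x (E i)))" .
    qed
    show "game_value (\<Union>i. E i) \<le> ennreal s * ?c"
    proof (rule ennreal_le_epsilon)
      fix e :: real assume "0 < e"
      then obtain U where U: "superfarthingale U" "reaches U (\<Union>i. H i)" "U [] < ennreal e"
        using game_lessD[of "\<Union>i. H i" "ennreal e"] N by auto
      have "reaches (\<lambda>x. ennreal s * W x + U x) (\<Union>i. E i)"
        unfolding reaches_def
      proof
        fix \<pi> assume "\<pi> \<in> (\<Union>i. E i)"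
        then obtain i where i: "\<pi> \<in> E i" by auto
        show "\<exists>n. 1 \<le> ennreal s * W (init_seg \<pi> n) + U (init_seg \<pi> n)"
        proof (cases "\<pi> \<in> H i")
          case True
          then obtain n where "1 \<le> U (init_seg \<pi> n)" using reachesE[OF U(2)] by blast
          then have "1 \<le> ennreal s * W (init_seg \<pi> n) + U (init_seg \<pi> n)"
            by (rule add_increasing[OF zero_le])
          then show ?thesis ..
        next
          case False
          then obtain k where "a < game_value (after (init_seg \<pi> k) (E i))" using i
            by (auto simp: H_def not_le)
          also have "\<dots> \<le> W (init_seg \<pi> k)" unfolding W_def by (intro SUP_upper) auto
          finally have "ennreal s * a \<le> ennreal s * W (init_seg \<pi> k)" by (intro mult_left_mono) auto
          then have "1 \<le> ennreal s * W (init_seg \<pi> k) + U (init_seg \<pi> k)"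
            unfolding sa by (rule add_increasing2[OF zero_le])
          then show ?thesis ..
        qed
      qed
      then have "game_value (\<Union>i. E i) \<le> ennreal s * W [] + U []"
        by (intro game_le superfarthingale_add superfarthingale_cmult W U)
      also have "\<dots> \<le> ennreal s * ?c + e"
        using U(3) by (intro add_mono) (auto simp: W_def)
      finally show "game_value (\<Union>i. E i) \<le> ennreal s * ?c + ennreal e" .
    qed
  qed
qed

section \<open>Expectations under a forecasting system\<close>

text \<open>
  The expectation of \<open>g\<close> over the first \<open>n\<close> outcomes generated by \<open>\<phi>\<close>, as a recursion on
  the first outcome. This form suits both the gluing of forecasting systems and the continuity in \<open>\<phi>\<close>.
\<close>
primrec forecast_expect :: "nat \<Rightarrow> (bool list \<Rightarrow> real) \<Rightarrow> (bool list \<Rightarrow> ennreal) \<Rightarrow> ennreal" where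
  "forecast_expect 0 \<phi> g = g []"
| "forecast_expect (Suc n) \<phi> g =
     mix (\<phi> []) (forecast_expect n (\<lambda>y. \<phi> (False # y)) (\<lambda>y. g (False # y)))
                (forecast_expect n (\<lambda>y. \<phi> (True # y)) (\<lambda>y. g (True # y)))"

primrec forecast_seg :: "(bool list \<Rightarrow> real) \<Rightarrow> bool list \<Rightarrow> (real \<times> bool) list" where
  "forecast_seg \<phi> [] = []"
| "forecast_seg \<phi> (b # y) = (\<phi> [], b) # forecast_seg (\<lambda>x. \<phi> (b # x)) y"

lemma forecast_seg_snoc: "forecast_seg \<phi> (y @ [b]) = forecast_seg \<phi> y @ [(\<phi> y, b)]"
  by (induction y arbitrary: \<phi>) auto

lemma init_seg_forecast_path: "init_seg (forecast_path \<phi> \<omega>) n = forecast_seg \<phi> (init_seg \<omega> n)"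
  by (induction n) (simp_all add: init_seg_Suc forecast_seg_snoc, simp add: forecast_path_def)

lemma length_forecast_seg [simp]: "length (forecast_seg \<phi> y) = length y"
  by (induction y arbitrary: \<phi>) auto

lemma forecasting_systemD: "forecasting_system \<phi> \<Longrightarrow> \<phi> x \<in> {0..1}"
  unfolding forecasting_system_def by blast

lemma forecasting_system_shift: "forecasting_system \<phi> \<Longrightarrow> forecasting_system (\<lambda>y. \<phi> (x @ y))"
  unfolding forecasting_system_def by blast

lemma forecast_expect_mono:
  "(\<And>y. length y = n \<Longrightarrow> g y \<le> h y) \<Longrightarrow> forecast_expect n \<phi> g \<le> forecast_expect n \<phi> h"
  by (induction n arbitrary: \<phi> g h) (auto intro!: mix_mono)

lemma forecast_expect_le_const:
  "forecasting_system \<phi> \<Longrightarrow> (\<And>y. length y = n \<Longrightarrow> g y \<le> c) \<Longrightarrow> forecast_expect n \<phi> g \<le> c"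
proof (induction n arbitrary: \<phi> g)
  case (Suc n)
  have "forecast_expect (Suc n) \<phi> g \<le> mix (\<phi> []) c c"
    unfolding forecast_expect.simps
    using Suc.prems forecasting_system_shift[OF Suc.prems(1), of "[_]"]
    by (intro mix_mono Suc.IH) auto
  then show ?case using forecasting_systemD[OF Suc.prems(1)] by simp
qed simp

text \<open>
  Along the path that \<open>\<phi>\<close> forecasts, a superfarthingale is an ordinary supermartingale.
\<close>
lemma forecast_expect_superfarthingale_le:
  "forecasting_system \<phi> \<Longrightarrow> superfarthingale S \<Longrightarrow>
    forecast_expect n \<phi> (\<lambda>y. S (forecast_seg \<phi> y)) \<le> S []"
proof (induction n arbitrary: \<phi> S)
  case (Suc n)
  have "forecast_expect n (\<lambda>y. \<phi> (b # y)) (\<lambda>y. S (forecast_seg \<phi> (b # y))) \<le> S ([] @ [(\<phi> [], b)])" for b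
    using Suc.IH[OF forecasting_system_shift[OF Suc.prems(1), of "[b]"]
        superfarthingale_shift[OF Suc.prems(2), of "[(\<phi> [], b)]"]]
    by simp
  then have "forecast_expect (Suc n) \<phi> (\<lambda>y. S (forecast_seg \<phi> y))
      \<le> mix (\<phi> []) (S ([] @ [(\<phi> [], False)])) (S ([] @ [(\<phi> [], True)]))"
    unfolding forecast_expect.simps by (intro mix_mono)
  also have "\<dots> \<le> S []"
    using Suc.prems by (intro superfarthingaleD forecasting_systemD)
  finally show ?case .
qed simp

section \<open>The measure of a forecasting system\<close>

lemma extensions_Nil [simp]: "extensions [] = UNIV"
  by (simp add: extensions_def)

lemma in_extensions_snoc: "\<omega> \<in> extensions (x @ [b]) \<longleftrightarrow> \<omega> \<in> extensions x \<and> \<omega> (length x) = b"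
  by (simp add: extensions_def init_seg_Suc)

lemma in_extensions_iff: "\<omega> \<in> extensions x \<longleftrightarrow> (\<forall>i<length x. \<omega> i = x ! i)"
  unfolding extensions_def mem_Collect_eq list_eq_iff_nth_eq by (simp add: init_seg_def)

lemma extensions_snoc_Un: "extensions x = extensions (x @ [False]) \<union> extensions (x @ [True])"
  by (auto simp: in_extensions_snoc)

lemma extensions_snoc_disjoint: "extensions (x @ [False]) \<inter> extensions (x @ [True]) = {}"
  by (auto simp: in_extensions_snoc)

lemma open_extensions: "open (extensions x)"
proof -
  have "extensions x = (\<Inter>i\<in>{..<length x}. (\<lambda>\<omega>. \<omega> i) -` {x ! i})"
    by (simp add: set_eq_iff in_extensions_iff) blast
  moreover have "open ((\<lambda>\<omega>::nat \<Rightarrow> bool. \<omega> i) -` {x ! i})" for i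
    by (rule open_vimage[OF Topological_Spaces.open_discrete continuous_on_product_coordinates])
  ultimately show ?thesis by (auto intro!: open_INT)
qed

text \<open>
  A neighbourhood in the product topology restricts only finitely many coordinates, so it contains a
  cylinder around each of its points, and there are only countably many cylinders.
\<close>
lemma borel_eq_sigma_extensions:
  "sets (borel :: (nat \<Rightarrow> bool) measure) = sigma_sets UNIV (insert {} (range extensions))"
proof
  have "U \<in> sigma_sets UNIV (insert {} (range extensions))" if "open U" for U :: "(nat \<Rightarrow> bool) set"
  proof -
    have "\<exists>n. extensions (init_seg \<omega> n) \<subseteq> U" if "\<omega> \<in> U" for \<omega>
    proof -
      have "openin (product_topology (\<lambda>_. euclidean) UNIV) U"
        using \<open>open U\<close> by (simp add: open_fun_def)
      from product_topology_open_contains_basis[OF this \<open>\<omega> \<in> U\<close>]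
      obtain X where X: "\<omega> \<in> Pi\<^sub>E UNIV X" "finite {i. X i \<noteq> UNIV}" "Pi\<^sub>E UNIV X \<subseteq> U"
        unfolding topspace_euclidean by blast
      obtain n where "\<forall>i\<in>{i. X i \<noteq> UNIV}. i < n"
        using X(2) unfolding finite_nat_set_iff_bounded by blast
      then have n: "\<And>i. X i \<noteq> UNIV \<Longrightarrow> i < n" by blast
      have "extensions (init_seg \<omega> n) \<subseteq> Pi\<^sub>E UNIV X"
      proof
        fix \<rho> assume "\<rho> \<in> extensions (init_seg \<omega> n)"
        then have eq: "\<rho> i = \<omega> i" if "i < n" for i
          using that by (simp add: in_extensions_iff init_seg_def)
        have "\<rho> i \<in> X i" for i
        proof (cases "i < n")
          case True
          then show ?thesis using eq PiE_mem[OF X(1) UNIV_I] by simp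
        next
          case False
          then show ?thesis using n by blast
        qed
        then show "\<rho> \<in> Pi\<^sub>E UNIV X" by (simp add: PiE_UNIV_domain)
      qed
      with X(3) show ?thesis by blast
    qed
    then have "U = (\<Union>x\<in>{x. extensions x \<subseteq> U}. extensions x)"
      by (auto simp: extensions_def) (metis length_init_seg)
    moreover have "(\<Union>x\<in>{x. extensions x \<subseteq> U}. extensions x)
        \<in> sigma_sets UNIV (insert {} (range extensions))"
      by (intro sigma_sets_UNION) (auto intro: countable_image)
    ultimately show ?thesis by simp
  qed
  then have "sigma_sets UNIV {U :: (nat \<Rightarrow> bool) set. open U}
      \<subseteq> sigma_sets UNIV (insert {} (range extensions))"
    by (intro sigma_sets_mono) auto
  then show "sets (borel :: (nat \<Rightarrow> bool) measure) \<subseteq> sigma_sets UNIV (insert {} (range extensions))"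
    by (simp add: borel_def)
  show "sigma_sets UNIV (insert {} (range extensions)) \<subseteq> sets (borel :: (nat \<Rightarrow> bool) measure)"
    using open_extensions by (intro sets.sigma_sets_subset') auto
qed

lemma Int_stable_extensions: "Int_stable (insert {} (range extensions))"
proof -
  have *: "extensions x \<inter> extensions y \<in> insert {} (range extensions)" if "length x \<le> length y" for x y
  proof (cases "extensions x \<inter> extensions y = {}")
    case False
    then obtain \<omega> where "init_seg \<omega> (length x) = x" "init_seg \<omega> (length y) = y"
      by (auto simp: extensions_def)
    then have x: "x = take (length x) y" using that by (metis take_init_seg)
    have "init_seg \<rho> (length x) = x" if "init_seg \<rho> (length y) = y" for \<rho>
      using x take_init_seg[OF \<open>length x \<le> length y\<close>, of \<rho>] that by simp
    then have "extensions x \<inter> extensions y = extensions y" by (auto simp: extensions_def)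
    then show ?thesis by auto
  qed simp
  have "extensions x \<inter> extensions y \<in> insert {} (range extensions)" for x y
    using *[of x y] *[of y x] by (cases "length x \<le> length y") (auto simp: Int_commute)
  then show ?thesis by (auto simp: Int_stable_def)
qed

text \<open>
  The property that singles out \<^const>\<open>forecast_measure\<close>, named so that existence and uniqueness can be stated.
\<close>
definition obeys :: "(nat \<Rightarrow> bool) measure \<Rightarrow> (bool list \<Rightarrow> real) \<Rightarrow> bool" where
  "obeys M \<phi> \<longleftrightarrow> prob_space M \<and> sets M = sets borel \<and>
     (\<forall>x. measure M (extensions (x @ [True])) = \<phi> x * measure M (extensions x))"

lemma obeys_snoc:
  assumes "obeys M \<phi>" and \<phi>: "\<phi> x \<in> {0..1}"
  shows "emeasure M (extensions (x @ [b])) = ennreal (if b then \<phi> x else 1 - \<phi> x) * emeasure M (extensions x)"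
proof -
  interpret prob_space M using assms by (simp add: obeys_def)
  have [measurable_cong]: "sets M = sets borel" using assms by (simp add: obeys_def)
  have [measurable]: "extensions y \<in> sets M" for y
    using open_extensions by (simp add: \<open>sets M = sets borel\<close>)
  have T: "prob (extensions (x @ [True])) = \<phi> x * prob (extensions x)"
    using assms by (simp add: obeys_def)
  have "prob (extensions x) = prob (extensions (x @ [False])) + prob (extensions (x @ [True]))"
    by (subst extensions_snoc_Un) (intro finite_measure_Union extensions_snoc_disjoint, auto)
  with T have "prob (extensions (x @ [b])) = (if b then \<phi> x else 1 - \<phi> x) * prob (extensions x)"
    by (cases b) (auto simp: algebra_simps)
  then show ?thesis using \<phi> by (simp add: emeasure_eq_measure ennreal_mult'')
qed

text \<open>
  Cylinders are stable under intersection and generate the Borel sets, and the forecasts fix their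
  probabilities one outcome at a time.
\<close>
lemma obeys_unique:
  assumes \<phi>: "forecasting_system \<phi>" and M: "obeys M \<phi>" and N: "obeys N \<phi>"
  shows "M = N"
proof (rule measure_eqI_generator_eq[OF Int_stable_extensions, where \<Omega> = UNIV and A = "\<lambda>_. UNIV"])
  have *: "emeasure M (extensions x) = emeasure N (extensions x)" for x
  proof (induction x rule: rev_induct)
    case Nil
    from M N have "prob_space M" "space M = UNIV" "prob_space N" "space N = UNIV"
      using sets_eq_imp_space_eq[of M borel] sets_eq_imp_space_eq[of N borel] by (auto simp: obeys_def)
    then show ?case using prob_space.emeasure_space_1 by (metis extensions_Nil)
  next
    case (snoc b x)
    then show ?case
      by (simp only: obeys_snoc[OF M forecasting_systemD[OF \<phi>]] obeys_snoc[OF N forecasting_systemD[OF \<phi>]])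
  qed
  then show "emeasure M X = emeasure N X" if "X \<in> insert {} (range extensions)" for X
    using that by auto
  show "sets M = sigma_sets UNIV (insert {} (range extensions))"
    "sets N = sigma_sets UNIV (insert {} (range extensions))"
    using M N by (simp_all add: obeys_def borel_eq_sigma_extensions)
  show "emeasure M UNIV \<noteq> \<infinity>" for i :: nat
    using M prob_space.emeasure_le_1[of M UNIV] by (auto simp: obeys_def top_unique)
  show "range (\<lambda>_::nat. UNIV) \<subseteq> insert {} (range extensions)"
    by (auto simp flip: extensions_Nil)
qed auto

text \<open>
  For existence, put an independent coin with probability \<open>\<phi> x\<close> of heads at every node \<open>x\<close> of the binary tree and
  follow the path through the tree that the coins \<open>c\<close> dictate. Membership in a cylinder then depends on the
  coins at finitely many distinct nodes, so its probability is a product.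
\<close>
primrec coin_seg :: "(bool list \<Rightarrow> bool) \<Rightarrow> nat \<Rightarrow> bool list" where
  "coin_seg c 0 = []"
| "coin_seg c (Suc n) = coin_seg c n @ [c (coin_seg c n)]"

definition coin_path :: "(bool list \<Rightarrow> bool) \<Rightarrow> nat \<Rightarrow> bool" where
  "coin_path c n = c (coin_seg c n)"

lemma init_seg_coin_path: "init_seg (coin_path c) n = coin_seg c n"
  by (induction n) (simp_all add: init_seg_Suc coin_path_def)

lemma coin_path_in_extensions: 
  "coin_path c \<in> extensions x \<longleftrightarrow> (\<forall>i<length x. c (take i x) = x ! i)"
proof (induction x rule: rev_induct)
  case (snoc b x)
  have *: "coin_path c (length x) = c x" if "coin_path c \<in> extensions x"
    using that init_seg_coin_path[of c "length x"] by (simp add: extensions_def coin_path_def)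
  have "coin_path c \<in> extensions (x @ [b]) \<longleftrightarrow> coin_path c \<in> extensions x \<and> c x = b"
    unfolding in_extensions_snoc using * by metis
  also have "\<dots> \<longleftrightarrow> (\<forall>i<length (x @ [b]). c (take i (x @ [b])) = (x @ [b]) ! i)"
    unfolding snoc by (simp add: All_less_Suc nth_append conj_commute cong: conj_cong)
  finally show ?case .
qed simp

lemma obeys_exists:
  assumes \<phi>: "forecasting_system \<phi>"
  obtains M where "obeys M \<phi>"
proof -
  define K where "K x = measure_pmf (bernoulli_pmf (\<phi> x))" for x
  interpret K: product_prob_space K UNIV
    unfolding product_prob_space_def product_prob_space_axioms_def product_sigma_finite_def
    by (auto simp: K_def prob_space_measure_pmf prob_space_imp_sigma_finite)
  let ?P = "Pi\<^sub>M UNIV K"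
  have space_P: "space ?P = UNIV" by (simp add: space_PiM K_def PiE_UNIV_domain)
  define J where "J x = (\<lambda>i. take i x) ` {..<length x}" for x :: "bool list"
  have ev: "{c. coin_path c \<in> extensions x} = {c\<in>space ?P. \<forall>t\<in>J x. c t \<in> {x ! length t}}" for x
    unfolding coin_path_in_extensions space_P J_def by (simp add: set_eq_iff) blast
  have meas: "{c. coin_path c \<in> extensions x} \<in> sets ?P" for x
    unfolding ev by (intro sets.sets_Collect_finite_All sets_Collect_single)
      (auto simp: J_def K_def sets_Collect_single)
  have em: "emeasure ?P {c. coin_path c \<in> extensions x}
      = (\<Prod>i<length x. ennreal (pmf (bernoulli_pmf (\<phi> (take i x))) (x ! i)))" for x
  proof -
    have "emeasure ?P {c. coin_path c \<in> extensions x} = (\<Prod>t\<in>J x. emeasure (K t) {x ! length t})"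
      unfolding ev by (intro K.emeasure_PiM_Collect) (auto simp: J_def K_def)
    also have "\<dots> = (\<Prod>i<length x. emeasure (K (take i x)) {x ! length (take i x)})"
      unfolding J_def 
      by (subst prod.reindex) (auto intro!: inj_onI dest: arg_cong[where f=length])
    also have "\<dots> = (\<Prod>i<length x. ennreal (pmf (bernoulli_pmf (\<phi> (take i x))) (x ! i)))"
      by (intro prod.cong) (auto simp: K_def emeasure_pmf_single)
    finally show ?thesis .
  qed
  have cp: "coin_path \<in> measurable ?P borel"
  proof (rule measurable_sigma_sets[OF borel_eq_sigma_extensions])
    fix X :: "(nat \<Rightarrow> bool) set" assume "X \<in> insert {} (range extensions)"
    then show "coin_path -` X \<inter> space ?P \<in> sets ?P"
      using meas by (auto simp: space_P vimage_def)
  qed auto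
  define M where "M = distr ?P borel coin_path"
  have eM: "emeasure M (extensions x) = emeasure ?P {c. coin_path c \<in> extensions x}" for x
    unfolding M_def using cp open_extensions
    by (subst emeasure_distr) (auto simp: space_P vimage_def)
  have "emeasure M (extensions (x @ [True])) = emeasure M (extensions x) * ennreal (\<phi> x)" for x
  proof -
    have "(\<Prod>i<length x. ennreal (pmf (bernoulli_pmf (\<phi> (take i (x @ [True])))) ((x @ [True]) ! i)))
       = (\<Prod>i<length x. ennreal (pmf (bernoulli_pmf (\<phi> (take i x))) (x ! i)))"
      by (intro prod.cong) (auto simp: nth_append)
    then show ?thesis
      using forecasting_systemD[OF \<phi>, of x] by (simp add: eM em)
  qed
  then have "measure M (extensions (x @ [True])) = \<phi> x * measure M (extensions x)" for x
    using forecasting_systemD[OF \<phi>, of x] by (simp add: measure_def enn2real_mult)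
  moreover have "prob_space M"
    unfolding M_def using cp by (rule K.P.prob_space_distr)
  ultimately have "obeys M \<phi>" by (simp add: obeys_def M_def)
  then show thesis by (rule that)
qed

lemma obeys_forecast_measure:
  assumes "forecasting_system \<phi>"
  shows "obeys (forecast_measure \<phi>) \<phi>"
proof -
  obtain M where M: "obeys M \<phi>" using assms by (rule obeys_exists)
  have "forecast_measure \<phi> = (THE M. obeys M \<phi>)"
    by (simp add: forecast_measure_def obeys_def)
  also have "\<dots> = M" using M obeys_unique[OF assms] by (intro the_equality) auto
  finally show ?thesis using M by simp
qed

lemma measurable_init_seg: "{\<omega>. Q (init_seg \<omega> n)} \<in> sets (borel :: (nat \<Rightarrow> bool) measure)"
proof -
  have "{\<omega>. Q (init_seg \<omega> n)} = (\<Union>x\<in>{x. length x = n \<and> Q x}. extensions x)"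
    by (auto simp: extensions_def)
  then show ?thesis using open_extensions by (auto intro!: borel_open)
qed

text \<open>
  Stated for every cylinder because the induction on the horizon conditions on one more
  outcome.
\<close>
lemma emeasure_extensions_Int:
  assumes \<phi>: "forecasting_system \<phi>" and M: "obeys M \<phi>"
  shows "emeasure M (extensions x \<inter> {\<omega>. Q (init_seg \<omega> (length x + n))})
    = emeasure M (extensions x) * forecast_expect n (\<lambda>y. \<phi> (x @ y)) (\<lambda>y. if Q (x @ y) then 1 else 0)"
proof (induction n arbitrary: x)
  case 0
  have "extensions x \<inter> {\<omega>. Q (init_seg \<omega> (length x + 0))} = (if Q x then extensions x else {})"
    by (auto simp: extensions_def)
  then show ?case by simp
next
  case (Suc n)
  have sets_M: "sets M = sets borel" using M by (simp add: obeys_def)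
  let ?B = "{\<omega>. Q (init_seg \<omega> (Suc (length x + n)))}"
  have "emeasure M (extensions x \<inter> ?B)
      = emeasure M ((extensions (x @ [False]) \<inter> ?B) \<union> (extensions (x @ [True]) \<inter> ?B))"
    by (subst extensions_snoc_Un) (simp add: Int_Un_distrib2)
  also have "\<dots> = emeasure M (extensions (x @ [False]) \<inter> ?B) + emeasure M (extensions (x @ [True]) \<inter> ?B)"
    using extensions_snoc_disjoint[of x] open_extensions measurable_init_seg
    by (intro plus_emeasure[symmetric]) (auto simp: sets_M intro!: sets.Int)
  finally show ?case
    using Suc.IH[of "x @ [False]"] Suc.IH[of "x @ [True]"]
    by (simp add: obeys_snoc[OF M forecasting_systemD[OF \<phi>]] mix_def distrib_left mult.assoc mult.left_commute)
qed

lemma emeasure_forecast_measure: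
  assumes \<phi>: "forecasting_system \<phi>"
  shows "emeasure (forecast_measure \<phi>) {\<omega>. Q (init_seg \<omega> n)}
    = forecast_expect n \<phi> (\<lambda>y. if Q y then 1 else 0)"
proof -
  have M: "obeys (forecast_measure \<phi>) \<phi>" using \<phi> by (rule obeys_forecast_measure)
  then have "prob_space (forecast_measure \<phi>)" "space (forecast_measure \<phi>) = UNIV"
    using sets_eq_imp_space_eq[of "forecast_measure \<phi>" borel] by (auto simp: obeys_def)
  then have "emeasure (forecast_measure \<phi>) UNIV = 1" by (metis prob_space.emeasure_space_1)
  with emeasure_extensions_Int[OF \<phi> M, of "[]" Q n] show ?thesis by simp
qed

section \<open>Superfarthingales give the upper game-theoretic probability\<close>

lemma enn2ereal_mix:
  "p \<in> {0..1} \<Longrightarrow> enn2ereal (mix p a b) = ereal (1 - p) * enn2ereal a + ereal p * enn2ereal b"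
  by (simp add: mix_def plus_ennreal.rep_eq times_ennreal.rep_eq)

lemma prequential_finite_snoc:
  "x @ [(p, b)] \<in> prequential_finite \<longleftrightarrow> x \<in> prequential_finite \<and> p \<in> {0..1}"
  by (auto simp: prequential_finite_def)

lemma init_seg_prequential: "\<pi> \<in> prequential_space \<Longrightarrow> init_seg \<pi> n \<in> prequential_finite"
  by (auto simp: prequential_space_def prequential_finite_def init_seg_def)

text \<open>
  An upper limit of at least 1 means that every threshold \<open>1 / s\<close> with \<open>s > 1\<close> is passed.
\<close>
lemma game_le_farthingale:
  assumes E: "E \<subseteq> prequential_space"
    and V: "farthingale V" "\<forall>x\<in>prequential_finite. 0 \<le> V x"
    and lim: "\<forall>\<pi>\<in>E. limsup (\<lambda>n. V (init_seg \<pi> n)) \<ge> 1"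
  shows "enn2ereal (game_value E) \<le> V []"
proof -
  have Nil: "[] \<in> prequential_finite" by (simp add: prequential_finite_def)
  define S where "S x = (if x \<in> prequential_finite then e2ennreal (V x) else 0)" for x
  have VS: "V x = enn2ereal (S x)" if "x \<in> prequential_finite" for x
    using V(2) that by (simp add: S_def enn2ereal_e2ennreal)
  have S: "superfarthingale S"
    unfolding superfarthingale_def
  proof (intro allI ballI)
    fix x and p :: real assume p: "p \<in> {0..1}"
    show "mix p (S (x @ [(p, False)])) (S (x @ [(p, True)])) \<le> S x"
    proof (cases "x \<in> prequential_finite")
      case True
      with p have x: "x @ [(p, b)] \<in> prequential_finite" for b by (simp add: prequential_finite_snoc)
      have "enn2ereal (mix p (S (x @ [(p, False)])) (S (x @ [(p, True)])))
        = ereal (1 - p) * V (x @ [(p, False)]) + ereal p * V (x @ [(p, True)])"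
        by (simp only: enn2ereal_mix[OF p] VS[OF x])
      also have "\<dots> = V x" using V(1) True p unfolding farthingale_def by simp
      finally show ?thesis using VS[OF True] by (simp add: less_eq_ennreal.rep_eq)
    next
      case False
      then have "S (x @ [(p, b)]) = 0" for b by (simp add: S_def prequential_finite_snoc)
      then show ?thesis using p by simp
    qed
  qed
  have "game_value E \<le> S []"
  proof (rule ennreal_le_of_le_mult)
    fix s :: real assume "1 < s"
    have "reaches (\<lambda>x. ennreal s * S x) E"
      unfolding reaches_def
    proof (rule ballI, rule ccontr)
      fix \<pi> assume \<pi>: "\<pi> \<in> E" and no: "\<nexists>n. 1 \<le> ennreal s * S (init_seg \<pi> n)"
      have "V (init_seg \<pi> n) \<le> ereal (1 / s)" for n
      proof -
        have "ennreal s * S (init_seg \<pi> n) \<le> 1" using no by (metis le_cases)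
        then have "S (init_seg \<pi> n) \<le> ennreal (1 / s)"
          using \<open>1 < s\<close>
          by (cases "S (init_seg \<pi> n)")
            (auto simp: ennreal_mult_top top_unique field_simps simp flip: ennreal_mult ennreal_1)
        then show ?thesis
          using VS[OF init_seg_prequential] \<pi> E \<open>1 < s\<close> by (auto simp: less_eq_ennreal.rep_eq)
      qed
      then have "limsup (\<lambda>n. V (init_seg \<pi> n)) \<le> ereal (1 / s)"
        by (intro Limsup_bounded) simp
      with lim \<pi> have "1 \<le> ereal (1 / s)" by (meson order_trans)
      with \<open>1 < s\<close> show False by simp
    qed
    then show "game_value E \<le> ennreal s * S []"
      by (intro game_le superfarthingale_cmult S)
  qed
  then show ?thesis using VS[OF Nil] by (simp add: less_eq_ennreal.rep_eq)
qed

text \<open>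
  Money thrown away is kept instead: adding all the past losses to \<open>S\<close> restores equality.
  Boundedness of \<open>S\<close> permits real subtraction here.
\<close>
lemma superfarthingale_dominated:
  assumes S: "superfarthingale S" and S1: "\<And>x. S x \<le> 1"
  obtains V :: "(real \<times> bool) list \<Rightarrow> ereal"
  where "farthingale V" "V [] = enn2ereal (S [])" "\<And>x. x \<in> prequential_finite \<Longrightarrow> enn2ereal (S x) \<le> V x"
proof -
  define R where "R x = enn2real (S x)" for x
  have SR: "S x = ennreal (R x)" for x
    using le_less_trans[OF S1[of x] ennreal_one_less_top] by (simp add: R_def)
  have R0: "0 \<le> R x" for x by (simp add: R_def)
  define waste where "waste x p = R x - ((1 - p) * R (x @ [(p, False)]) + p * R (x @ [(p, True)]))" for x p
  have waste: "0 \<le> waste x p" if p: "p \<in> {0..1}" for x p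
  proof -
    have "ennreal ((1 - p) * R (x @ [(p, False)]) + p * R (x @ [(p, True)])) \<le> ennreal (R x)"
      using superfarthingaleD[OF S p, of x] p R0
      by (simp add: mix_def SR flip: ennreal_mult ennreal_plus)
    then show ?thesis using R0 by (simp add: waste_def)
  qed
  define W where "W x = R x + (\<Sum>i<length x. waste (take i x) (fst (x ! i)))" for x
  have W_snoc: "W (x @ [(p, b)]) = R (x @ [(p, b)]) + (W x - R x) + waste x p" for x p b
  proof -
    have "(\<Sum>i<length x. waste (take i (x @ [(p, b)])) (fst ((x @ [(p, b)]) ! i)))
        = (\<Sum>i<length x. waste (take i x) (fst (x ! i)))"
      by (intro sum.cong) (auto simp: nth_append)
    then show ?thesis by (simp add: W_def)
  qed
  show thesis
  proof (rule that[of "\<lambda>x. ereal (W x)"])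
    show "farthingale (\<lambda>x. ereal (W x))"
      unfolding farthingale_def by (auto simp: W_snoc waste_def algebra_simps)
    show "ereal (W []) = enn2ereal (S [])" by (simp add: W_def SR R0)
    show "enn2ereal (S x) \<le> ereal (W x)" if "x \<in> prequential_finite" for x
    proof -
      have "0 \<le> (\<Sum>i<length x. waste (take i x) (fst (x ! i)))"
        using that by (intro sum_nonneg waste) (auto simp: prequential_finite_def)
      then show ?thesis by (simp add: W_def SR R0)
    qed
  qed
qed

text \<open>
  Stopping serves twice: it bounds the capital, and it makes the capital stay at 1, so
  that reaching 1 once yields a limit instead of a single good moment.
\<close>
lemma upper_game_prob_le:
  assumes E: "E \<subseteq> prequential_space" and S: "superfarthingale S" "reaches S E"
  shows "upper_game_prob E \<le> enn2ereal (S [])"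
proof -
  obtain V :: "(real \<times> bool) list \<Rightarrow> ereal" where V: "farthingale V" "V [] = enn2ereal (stopped S [])"
    "\<And>x. x \<in> prequential_finite \<Longrightarrow> enn2ereal (stopped S x) \<le> V x"
    using superfarthingale_dominated[OF superfarthingale_stopped[OF S(1)] stopped_le_1] by blast
  have "limsup (\<lambda>n. V (init_seg \<pi> n)) \<ge> 1" if \<pi>: "\<pi> \<in> E" for \<pi>
  proof (rule le_Limsup)
    from S(2) \<pi> obtain n where n: "1 \<le> S (init_seg \<pi> n)" by (rule reachesE)
    have "1 \<le> V (init_seg \<pi> m)" if "n \<le> m" for m
      using V(3)[OF init_seg_prequential, of \<pi> m] stopped_eq_1[of S, OF n that] \<pi> E
      by (auto simp: one_ennreal.rep_eq)
    then show "\<forall>\<^sub>F m in sequentially. 1 \<le> V (init_seg \<pi> m)"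
      by (auto simp: eventually_sequentially)
  qed simp
  moreover have "0 \<le> V x" if "x \<in> prequential_finite" for x
    using order_trans[OF enn2ereal_nonneg V(3)[OF that]] .
  ultimately have "upper_game_prob E \<le> V []"
    unfolding upper_game_prob_def using V(1) by (intro Inf_lower) blast
  also have "\<dots> \<le> enn2ereal (S [])"
    unfolding V(2) using stopped_Nil_le[of S] by (simp add: less_eq_ennreal.rep_eq)
  finally show ?thesis .
qed

lemma upper_game_prob_eq_game:
  assumes E: "E \<subseteq> prequential_space"
  shows "upper_game_prob E = enn2ereal (game_value E)"
proof (rule antisym)
  show le: "enn2ereal (game_value E) \<le> upper_game_prob E"
    unfolding upper_game_prob_def using game_le_farthingale[OF E] by (intro Inf_greatest) blast
  have "e2ennreal (upper_game_prob E) \<le> game_value E"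
    using e2ennreal_mono[OF upper_game_prob_le[OF E]] by (intro game_greatest) simp
  moreover have "0 \<le> upper_game_prob E" using le by (rule order_trans[OF enn2ereal_nonneg])
  ultimately show "upper_game_prob E \<le> enn2ereal (game_value E)"
    by (simp add: less_eq_ennreal.rep_eq enn2ereal_e2ennreal)
qed

section \<open>The measure-theoretic probability is the smaller one\<close>

text \<open>
  Ville's inequality. The event that the stopped capital gets to 1 by time \<open>n\<close> is determined by finitely many
  outcomes, hence measurable, and the union of these events over \<open>n\<close> covers the outcome sequences whose path lies in \<open>E\<close>.
\<close>
lemma outer_measure_le_game:
  assumes \<phi>: "forecasting_system \<phi>"
  shows "outer_measure_of (forecast_measure \<phi>) {\<omega>. forecast_path \<phi> \<omega> \<in> E} \<le> game_value E"
proof (rule game_greatest)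
  fix S assume S: "superfarthingale S" "reaches S E"
  let ?M = "forecast_measure \<phi>"
  have sets_M: "sets ?M = sets borel" using obeys_forecast_measure[OF \<phi>] by (simp add: obeys_def)
  define B where "B n = {\<omega>. has_reached S (forecast_seg \<phi> (init_seg \<omega> n))}" for n
  have B_sets: "B n \<in> sets ?M" for n
    unfolding B_def sets_M by (rule measurable_init_seg)
  have "B n \<subseteq> B (Suc n)" for n
    by (auto simp: B_def init_seg_Suc forecast_seg_snoc has_reached_snoc)
  then have inc: "incseq B" by (rule incseq_SucI)
  have B_le: "emeasure ?M (B n) \<le> S []" for n
  proof -
    have "emeasure ?M (B n) = forecast_expect n \<phi> (\<lambda>y. if has_reached S (forecast_seg \<phi> y) then 1 else 0)"
      unfolding B_def by (rule emeasure_forecast_measure[OF \<phi>])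
    also have "\<dots> \<le> forecast_expect n \<phi> (\<lambda>y. stopped S (forecast_seg \<phi> y))"
      by (rule forecast_expect_mono) (simp add: stopped_def)
    also have "\<dots> \<le> stopped S []"
      by (intro forecast_expect_superfarthingale_le \<phi> superfarthingale_stopped S)
    also have "\<dots> \<le> S []" by (rule stopped_Nil_le)
    finally show ?thesis .
  qed
  have "{\<omega>. forecast_path \<phi> \<omega> \<in> E} \<subseteq> (\<Union>n. B n)"
  proof
    fix \<omega> assume "\<omega> \<in> {\<omega>. forecast_path \<phi> \<omega> \<in> E}"
    then have "forecast_path \<phi> \<omega> \<in> E" by simp
    with S(2) obtain n where "1 \<le> S (init_seg (forecast_path \<phi> \<omega>) n)" by (rule reachesE)
    then have "has_reached S (forecast_seg \<phi> (init_seg \<omega> n))"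
      unfolding has_reached_def init_seg_forecast_path by (intro exI[of _ n]) simp
    then show "\<omega> \<in> (\<Union>n. B n)" by (auto simp: B_def)
  qed
  then have "outer_measure_of ?M {\<omega>. forecast_path \<phi> \<omega> \<in> E} \<le> emeasure ?M (\<Union>n. B n)"
    unfolding outer_measure_of_def using B_sets by (intro INF_lower) auto
  also have "\<dots> = (SUP n. emeasure ?M (B n))"
    using B_sets inc by (intro SUP_emeasure_incseq[symmetric]) auto
  also have "\<dots> \<le> S []" using B_le by (rule SUP_least)
  finally show "outer_measure_of ?M {\<omega>. forecast_path \<phi> \<omega> \<in> E} \<le> S []" .
qed

section \<open>Finite horizon and limits of forecasting systems\<close>

text \<open>
  Backward induction: at the first move a near-worst forecast for the gambler is chosen, and near-worst
  forecasting systems for the two resulting positions are attached below it. At horizon \<open>n\<close> it is only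
  known that the path can still be completed to an element of \<open>E\<close>.
\<close>
lemma game_le_SUP_forecast_expect:
  "game_value E \<le> (SUP \<phi>\<in>{\<phi>. forecasting_system \<phi>}.
     forecast_expect n \<phi> (\<lambda>y. if \<exists>\<pi>\<in>E. init_seg \<pi> n = forecast_seg \<phi> y then 1 else 0))"
proof (induction n arbitrary: E)
  case 0
  have fs: "forecasting_system (\<lambda>_. 0)" by (simp add: forecasting_system_def)
  show ?case
    using game_le_1[of E] by (cases "E = {}") (auto intro!: SUP_upper2[of "\<lambda>_. 0"] fs)
next
  case (Suc n)
  let ?g = "\<lambda>E n \<phi> y. if \<exists>\<pi>\<in>E. init_seg \<pi> n = forecast_seg \<phi> y then 1 else (0::ennreal)"
  let ?F = "\<lambda>E n \<phi>. forecast_expect n \<phi> (?g E n \<phi>)"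
  let ?R = "SUP \<phi>\<in>{\<phi>. forecasting_system \<phi>}. ?F E (Suc n) \<phi>"
  have "mix p (game_value (after [(p, False)] E)) (game_value (after [(p, True)] E)) \<le> ?R"
    if p: "p \<in> {0..1}" for p
  proof (rule ennreal_le_epsilon)
    fix e :: real assume e: "0 < e"
    have "\<exists>\<phi>. forecasting_system \<phi> \<and> game_value (after [(p, b)] E) \<le> ?F (after [(p, b)] E) n \<phi> + e" for b
    proof -
      let ?S = "SUP \<phi>\<in>{\<phi>. forecasting_system \<phi>}. ?F (after [(p, b)] E) n \<phi>"
      have "?S \<le> 1" by (intro SUP_least forecast_expect_le_const) auto
      then have "?S < \<top>" by (rule le_less_trans) simp
      then have "?S \<noteq> \<infinity>" by (metis infinity_ennreal_def less_irrefl)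
      have ne: "{\<phi>. forecasting_system \<phi>} \<noteq> {}"
        by (auto simp: forecasting_system_def intro!: exI[of _ "\<lambda>_. 0"])
      obtain \<phi> where "forecasting_system \<phi>" "?S < ?F (after [(p, b)] E) n \<phi> + e"
        using SUP_approx_ennreal[OF e ne refl \<open>?S \<noteq> \<infinity>\<close>] by blast
      then show ?thesis using Suc.IH[of "after [(p, b)] E"]
        by (intro exI[of _ \<phi>] conjI) (auto dest: le_less_trans)
    qed
    then have "\<exists>\<phi>. \<forall>b. forecasting_system (\<phi> b) \<and> game_value (after [(p, b)] E) \<le> ?F (after [(p, b)] E) n (\<phi> b) + e"
      by (intro choice allI)
    then obtain \<phi> where \<phi>: "\<And>b. forecasting_system (\<phi> b)"
        "\<And>b. game_value (after [(p, b)] E) \<le> ?F (after [(p, b)] E) n (\<phi> b) + e"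
      by blast
    define \<psi> where "\<psi> y = (case y of [] \<Rightarrow> p | b # x \<Rightarrow> \<phi> b x)" for y
    have \<psi>: "forecasting_system \<psi>"
      using \<phi>(1) p by (auto simp: \<psi>_def forecasting_system_def split: list.split)
    have F: "?F (after [(p, b)] E) n (\<phi> b) \<le> forecast_expect n (\<lambda>y. \<psi> (b # y)) (\<lambda>y. ?g E (Suc n) \<psi> (b # y))" for b
    proof -
      have "?g (after [(p, b)] E) n (\<phi> b) y \<le> ?g E (Suc n) \<psi> (b # y)" for y
      proof -
        have "\<exists>\<pi>\<in>E. init_seg \<pi> (Suc n) = forecast_seg \<psi> (b # y)"
          if "\<rho> \<in> after [(p, b)] E" "init_seg \<rho> n = forecast_seg (\<phi> b) y" for \<rho>
          using that by (intro bexI[of _ "case_nat (p, b) \<rho>"]) (auto simp: \<psi>_def)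
        then show ?thesis by auto
      qed
      then show ?thesis by (simp add: \<psi>_def forecast_expect_mono)
    qed
    have "mix p (game_value (after [(p, False)] E)) (game_value (after [(p, True)] E))
      \<le> mix p (forecast_expect n (\<lambda>y. \<psi> (False # y)) (\<lambda>y. ?g E (Suc n) \<psi> (False # y)) + e)
              (forecast_expect n (\<lambda>y. \<psi> (True # y)) (\<lambda>y. ?g E (Suc n) \<psi> (True # y)) + e)"
      by (intro mix_mono order_trans[OF \<phi>(2)] add_mono F order_refl)
    also have "\<dots> = ?F E (Suc n) \<psi> + e"
      using p by (simp add: mix_add \<psi>_def)
    also have "\<dots> \<le> ?R + e" using \<psi> by (intro add_mono SUP_upper) auto
    finally show "mix p (game_value (after [(p, False)] E)) (game_value (after [(p, True)] E)) \<le> ?R + e" .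
  qed
  then have "(SUP p\<in>{0..1}. mix p (game_value (after [(p, False)] E)) (game_value (after [(p, True)] E))) \<le> ?R"
    by (rule SUP_least)
  with game_le_SUP_mix show ?case by (rule order_trans)
qed

lemma finite_horizon_forecast:
  assumes "c < game_value E"
  obtains \<phi> where "forecasting_system \<phi>"
    "c < emeasure (forecast_measure \<phi>) {\<omega>. \<exists>\<pi>\<in>E. init_seg \<pi> n = init_seg (forecast_path \<phi> \<omega>) n}"
proof -
  from less_le_trans[OF assms game_le_SUP_forecast_expect[of E n]]
  obtain \<phi> where \<phi>: "forecasting_system \<phi>"
    "c < forecast_expect n \<phi> (\<lambda>y. if \<exists>\<pi>\<in>E. init_seg \<pi> n = forecast_seg \<phi> y then 1 else 0)"
    by (auto simp: less_SUP_iff)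
  then show thesis
    by (intro that[of \<phi>]) (simp_all add: init_seg_forecast_path 
        emeasure_forecast_measure[where Q = "\<lambda>y. \<exists>\<pi>\<in>E. init_seg \<pi> n = forecast_seg \<phi> y"])
qed

lemma tendsto_mix:
  assumes "p \<longlonglongrightarrow> q" "a \<longlonglongrightarrow> l" "b \<longlonglongrightarrow> m" "l < \<top>" "m < \<top>"
  shows "(\<lambda>k. mix (p k) (a k) (b k)) \<longlonglongrightarrow> mix q l m"
  unfolding mix_def using assms
  by (intro tendsto_add tendsto_mult_ennreal tendsto_ennrealI tendsto_diff tendsto_const) auto

lemma tendsto_forecast_expect:
  assumes "\<And>k. forecasting_system (\<phi> k)" "\<And>y. (\<lambda>k. \<phi> k y) \<longlonglongrightarrow> \<psi> y" "forecasting_system \<psi>" "\<And>y. g y \<le> 1"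
  shows "(\<lambda>k. forecast_expect n (\<phi> k) g) \<longlonglongrightarrow> forecast_expect n \<psi> g"
  using assms
proof (induction n arbitrary: \<phi> \<psi> g)
  case (Suc n)
  have fin: "forecast_expect n (\<lambda>y. \<psi> (b # y)) (\<lambda>y. g (b # y)) < \<top>" for b
    using forecasting_system_shift[OF Suc.prems(3), of "[b]"] Suc.prems(4)
    by (intro le_less_trans[OF forecast_expect_le_const[where c = 1]]) auto
  have "(\<lambda>k. forecast_expect n (\<lambda>y. \<phi> k (b # y)) (\<lambda>y. g (b # y)))
      \<longlonglongrightarrow> forecast_expect n (\<lambda>y. \<psi> (b # y)) (\<lambda>y. g (b # y))" for b
    using forecasting_system_shift[OF Suc.prems(3), of "[b]"]
      forecasting_system_shift[OF Suc.prems(1), of _ "[b]"] Suc.prems(2,4)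
    by (intro Suc.IH) auto
  then show ?case
    unfolding forecast_expect.simps by (intro tendsto_mix Suc.prems fin)
qed simp

section \<open>Capacitability of analytic sets\<close>

lemma continuous_coordinate:
  assumes "continuous_map euclidean prequential_topology f"
  shows "continuous_on UNIV (\<lambda>x. f x j)"
proof -
  have "continuous_map euclidean (prod_topology (top_of_set {0..1}) euclidean) (\<lambda>x. f x j)"
    using assms by (simp add: prequential_topology_def continuous_map_componentwise_UNIV)
  then show ?thesis
    by (simp add: prod_topology_subtopology continuous_map_in_subtopology)
qed

lemma tendsto_coordinates:
  fixes X :: "nat \<Rightarrow> 'a \<Rightarrow> 'b::topological_space"
  shows "X \<longlonglongrightarrow> l \<longleftrightarrow> (\<forall>i. (\<lambda>n. X n i) \<longlonglongrightarrow> l i)"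
proof -
  have "limitin (product_topology (\<lambda>_. euclidean) UNIV) X l sequentially \<longleftrightarrow> (\<forall>i. (\<lambda>n. X n i) \<longlonglongrightarrow> l i)"
    by (simp add: limitin_componentwise)
  then show ?thesis by (simp add: euclidean_product_topology)
qed

lemma seq_compact_product:
  fixes K :: "'a::countable \<Rightarrow> 'b::first_countable_topology set"
  assumes "\<And>i. compact (K i)"
  shows "seq_compact (Pi\<^sub>E UNIV K)"
proof -
  have "compactin (product_topology (\<lambda>_. euclidean) UNIV) (Pi\<^sub>E UNIV K)"
    using assms by (simp add: compactin_PiE)
  then have "compact (Pi\<^sub>E UNIV K)" by (simp add: euclidean_product_topology)
  then show ?thesis by (rule compact_imp_seq_compact)
qed

text \<open>
  Choquet's construction. For the set of arguments bounded at the coordinates \<open>0, ..., k - 1\<close>, continuity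
  from below gives a bound for coordinate \<open>k\<close> that keeps the value above \<open>c\<close>.
\<close>
lemma bounding_sequence:
  fixes f :: "(nat \<Rightarrow> nat) \<Rightarrow> nat \<Rightarrow> real \<times> bool"
  assumes c: "c < game_value (range f)"
  obtains m :: "nat \<Rightarrow> nat" where "\<And>k. c < game_value (f ` {x. \<forall>i<k. x i \<le> m i})"
proof -
  define A where "A l = {x :: nat \<Rightarrow> nat. \<forall>i<length l. x i \<le> l ! i}" for l
  have step: "\<exists>m. c < game_value (f ` A (l @ [m]))" if "c < game_value (f ` A l)" for l
  proof -
    have A_snoc: "A (l @ [m]) = {x \<in> A l. x (length l) \<le> m}" for m
      by (auto simp: A_def nth_append less_Suc_eq)
    have "incseq (\<lambda>m. f ` A (l @ [m]))"
      by (intro incseq_SucI image_mono) (auto simp: A_snoc)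
    moreover have "f ` A l = (\<Union>m. f ` A (l @ [m]))"
      unfolding A_snoc by auto
    ultimately have "c < (SUP m. game_value (f ` A (l @ [m])))"
      using that game_incseq_le[of "\<lambda>m. f ` A (l @ [m])"] by simp
    then show ?thesis by (auto simp: less_SUP_iff)
  qed
  then obtain nx where nx: "\<And>l. c < game_value (f ` A l) \<Longrightarrow> c < game_value (f ` A (l @ [nx l]))" by metis
  define L where "L = rec_nat [] (\<lambda>_ l. l @ [nx l])"
  have L: "L 0 = []" "L (Suc k) = L k @ [nx (L k)]" for k by (simp_all add: L_def)
  have L_seg: "L k = init_seg (\<lambda>k. nx (L k)) k" for k
    by (induction k) (simp_all add: L init_seg_Suc)
  have "c < game_value (f ` A (L k))" for k
  proof (induction k)
    case 0
    have "A [] = UNIV" by (simp add: A_def)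
    with c show ?case by (simp add: L)
  next
    case (Suc k)
    then show ?case unfolding L by (rule nx)
  qed
  moreover have "A (L k) = {x. \<forall>i<k. x i \<le> nx (L i)}" for k
    unfolding A_def by (subst L_seg, subst (2) L_seg) (simp add: init_seg_def)
  ultimately show thesis using that[of "\<lambda>k. nx (L k)"] by simp
qed

text \<open>
  The \<open>n\<close>-th point obeys the bounds \<open>m\<close> only at its first \<open>n\<close> coordinates, so it need not lie in the compact box. Truncation
  puts it there without affecting the limit.
\<close>
lemma limit_of_bounded_images:
  fixes f :: "(nat \<Rightarrow> nat) \<Rightarrow> nat \<Rightarrow> 'b::t2_space"
  assumes f: "\<And>j. continuous_on UNIV (\<lambda>x. f x j)"
    and a: "\<And>n i. i < n \<Longrightarrow> a n i \<le> m i"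
    and lim: "\<And>j. (\<lambda>n. f (a n) j) \<longlonglongrightarrow> p j"
  shows "p \<in> range f"
proof -
  have "seq_compact (Pi\<^sub>E UNIV (\<lambda>i. {..m i}))"
    by (intro seq_compact_product finite_imp_compact) simp
  moreover have "\<forall>n. (\<lambda>i. min (a n i) (m i)) \<in> Pi\<^sub>E UNIV (\<lambda>i. {..m i})"
    by (simp add: PiE_UNIV_domain)
  ultimately obtain b s where s: "strict_mono (s :: nat \<Rightarrow> nat)"
    and b: "((\<lambda>n i. min (a n i) (m i)) \<circ> s) \<longlonglongrightarrow> b"
    by (rule seq_compactE)
  have "(\<lambda>n. a (s n) i) \<longlonglongrightarrow> b i" for i
  proof -
    have "(\<lambda>n. min (a (s n) i) (m i)) \<longlonglongrightarrow> b i"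
      using b by (simp add: tendsto_coordinates o_def)
    moreover have "\<forall>\<^sub>F n in sequentially. min (a (s n) i) (m i) = a (s n) i"
      using eventually_gt_at_top[of i]
    proof eventually_elim
      case (elim n)
      with seq_suble[OF s, of n] have "i < s n" by simp
      with a show ?case by (simp add: min_def)
    qed
    ultimately show ?thesis by (rule Lim_transform_eventually)
  qed
  then have "(\<lambda>n. a (s n)) \<longlonglongrightarrow> b" by (simp add: tendsto_coordinates)
  then have "(\<lambda>n. f (a (s n)) j) \<longlonglongrightarrow> f b j" for j
    using continuous_on_tendsto_compose[OF f] by auto
  moreover have "(\<lambda>n. f (a (s n)) j) \<longlonglongrightarrow> p j" for j
    using LIMSEQ_subseq_LIMSEQ[OF lim s] by (simp add: o_def)
  ultimately have "p = f b" by (intro ext) (rule LIMSEQ_unique)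
  then show ?thesis by simp
qed

text \<open>
  For each \<open>k\<close> a forecasting system gives probability above \<open>c\<close> to the paths that agree up to time \<open>k\<close> with a point
  of the image of the \<open>k\<close>-th Choquet set. Forecasting systems form a compact metrizable space, a product of countably many intervals, so a
  subsequence converges to some \<open>\<psi>\<close>. An outcome sequence is good if each of its prefixes is approved by infinitely many systems of
  the subsequence. Prefixes of a fixed length are finite in number, so under \<open>\<psi>\<close> the good sequences have probability at least
  \<open>c\<close>; and the path of a good sequence is a limit of images of points of the Choquet sets, hence a point of the range of \<open>f\<close>.
\<close>
lemma game_analytic_attained:
  fixes f :: "(nat \<Rightarrow> nat) \<Rightarrow> nat \<Rightarrow> real \<times> bool"
  assumes f: "\<And>j. continuous_on UNIV (\<lambda>x. f x j)" and c: "c < game_value (range f)"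
  obtains \<psi> where "forecasting_system \<psi>"
    "c \<le> outer_measure_of (forecast_measure \<psi>) {\<omega>. forecast_path \<psi> \<omega> \<in> range f}"
proof -
  obtain m :: "nat \<Rightarrow> nat" where m: "\<And>k. c < game_value (f ` {x. \<forall>i<k. x i \<le> m i})"
    using bounding_sequence[OF c] by blast
  define A where "A k = {x. \<forall>i<k. x i \<le> m i}" for k
  have "\<exists>\<phi>. forecasting_system \<phi> \<and> c < emeasure (forecast_measure \<phi>)
      {\<omega>. \<exists>\<pi>\<in>f ` A k. init_seg \<pi> k = init_seg (forecast_path \<phi> \<omega>) k}" for k
  proof -
    have "c < game_value (f ` A k)" using m by (simp add: A_def)
    then obtain \<phi> where "forecasting_system \<phi>" "c < emeasure (forecast_measure \<phi>)
        {\<omega>. \<exists>\<pi>\<in>f ` A k. init_seg \<pi> k = init_seg (forecast_path \<phi> \<omega>) k}"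
      by (rule finite_horizon_forecast)
    then show ?thesis by blast
  qed
  then have "\<exists>\<phi>. \<forall>k. forecasting_system (\<phi> k) \<and> c < emeasure (forecast_measure (\<phi> k))
      {\<omega>. \<exists>\<pi>\<in>f ` A k. init_seg \<pi> k = init_seg (forecast_path (\<phi> k) \<omega>) k}"
    by (intro choice allI)
  then obtain \<phi>' where \<phi>': "\<And>k. forecasting_system (\<phi>' k)"
      "\<And>k. c < emeasure (forecast_measure (\<phi>' k))
        {\<omega>. \<exists>\<pi>\<in>f ` A k. init_seg \<pi> k = init_seg (forecast_path (\<phi>' k) \<omega>) k}"
    by blast
  have "seq_compact (Pi\<^sub>E (UNIV :: bool list set) (\<lambda>_. {0..1 :: real}))"
    by (intro seq_compact_product compact_Icc)
  moreover have "\<forall>k. \<phi>' k \<in> Pi\<^sub>E UNIV (\<lambda>_. {0..1})"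
    using forecasting_systemD[OF \<phi>'(1)] by (simp add: PiE_UNIV_domain)
  ultimately obtain \<psi> r where \<psi>: "\<psi> \<in> Pi\<^sub>E UNIV (\<lambda>_. {0..1})"
    and r: "strict_mono (r :: nat \<Rightarrow> nat)" and lim: "(\<phi>' \<circ> r) \<longlonglongrightarrow> \<psi>"
    by (rule seq_compactE)
  have fs\<psi>: "forecasting_system \<psi>"
    using \<psi> by (auto simp: forecasting_system_def PiE_UNIV_domain)
  define \<phi> where "\<phi> k = \<phi>' (r k)" for k
  have fs\<phi>: "forecasting_system (\<phi> k)" for k by (simp add: \<phi>_def \<phi>')
  have lim: "(\<lambda>k. \<phi> k y) \<longlonglongrightarrow> \<psi> y" for y
    using lim by (simp add: tendsto_coordinates \<phi>_def o_def)
  have rk: "k \<le> r k" for k using seq_suble[OF r] .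
  \<comment> \<open>\<open>T n k y\<close>: the \<open>k\<close>-th system approves the prefix \<open>y\<close> of length \<open>n\<close>, in that its
    forecasts along \<open>y\<close> lead to an initial segment of a point in the image of its Choquet set.\<close>
  define T where "T n k y \<longleftrightarrow> (\<exists>a\<in>A (r k). init_seg (f a) n = forecast_seg (\<phi> k) y)" for n k y
  define D where "D n y \<longleftrightarrow> (\<exists>\<^sub>F k in sequentially. T n k y)" for n y
  have T_large: "c \<le> emeasure (forecast_measure (\<phi> k)) {\<omega>. T n k (init_seg \<omega> n)}" if "n \<le> k" for n k
  proof -
    have "n \<le> r k" using that rk[of k] by simp
    have "c < emeasure (forecast_measure (\<phi> k))
        {\<omega>. \<exists>\<pi>\<in>f ` A (r k). init_seg \<pi> (r k) = init_seg (forecast_path (\<phi> k) \<omega>) (r k)}"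
      unfolding \<phi>_def by (rule \<phi>'(2))
    also have "\<dots> \<le> emeasure (forecast_measure (\<phi> k)) {\<omega>. T n k (init_seg \<omega> n)}"
    proof (rule emeasure_mono)
      show "{\<omega>. T n k (init_seg \<omega> n)} \<in> sets (forecast_measure (\<phi> k))"
        using obeys_forecast_measure[OF fs\<phi>, of k] measurable_init_seg[of "T n k" n] by (simp add: obeys_def)
      show "{\<omega>. \<exists>\<pi>\<in>f ` A (r k). init_seg \<pi> (r k) = init_seg (forecast_path (\<phi> k) \<omega>) (r k)}
          \<subseteq> {\<omega>. T n k (init_seg \<omega> n)}"
        unfolding T_def by (auto simp flip: init_seg_forecast_path) (metis take_init_seg[OF \<open>n \<le> r k\<close>])
    qed
    finally show ?thesis by simp
  qed
  have D_large: "c \<le> emeasure (forecast_measure \<psi>) {\<omega>. D n (init_seg \<omega> n)}" for n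
  proof -
    let ?g = "\<lambda>y. if D n y then 1 else (0::ennreal)"
    have "\<forall>\<^sub>F k in sequentially. T n k y \<longrightarrow> D n y" for y
      by (cases "D n y") (auto simp: D_def not_frequently)
    moreover have "finite {y :: bool list. length y = n}"
      using finite_lists_length_eq[of "UNIV :: bool set" n] by simp
    ultimately have "\<forall>\<^sub>F k in sequentially. \<forall>y\<in>{y. length y = n}. T n k y \<longrightarrow> D n y"
      by (intro eventually_ball_finite ballI)
    then have "\<forall>\<^sub>F k in sequentially. c \<le> forecast_expect n (\<phi> k) ?g"
      using eventually_ge_at_top[of n]
    proof eventually_elim
      case (elim k)
      have "c \<le> forecast_expect n (\<phi> k) (\<lambda>y. if T n k y then 1 else 0)"
        using T_large[OF elim(2)] emeasure_forecast_measure[OF fs\<phi>, of k "T n k" n] by simp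
      also have "\<dots> \<le> forecast_expect n (\<phi> k) ?g"
        using elim(1) by (intro forecast_expect_mono) auto
      finally show ?case .
    qed
    moreover have "(\<lambda>k. forecast_expect n (\<phi> k) ?g) \<longlonglongrightarrow> forecast_expect n \<psi> ?g"
      by (intro tendsto_forecast_expect fs\<phi> lim fs\<psi>) simp
    ultimately have "c \<le> forecast_expect n \<psi> ?g"
      by (intro tendsto_lowerbound[of _ _ sequentially]) auto
    then show ?thesis by (simp add: emeasure_forecast_measure[OF fs\<psi>])
  qed
  have sets_\<psi>: "sets (forecast_measure \<psi>) = sets borel" and "prob_space (forecast_measure \<psi>)"
    using obeys_forecast_measure[OF fs\<psi>] by (simp_all add: obeys_def)
  then interpret prob_space "forecast_measure \<psi>" by simp
  define B where "B n = {\<omega>. D n (init_seg \<omega> n)}" for n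
  have B_sets: "B n \<in> sets (forecast_measure \<psi>)" for n
    unfolding B_def sets_\<psi> by (rule measurable_init_seg)
  have "B (Suc n) \<subseteq> B n" for n
  proof
    fix \<omega> assume "\<omega> \<in> B (Suc n)"
    then have "\<exists>\<^sub>F k in sequentially. T (Suc n) k (init_seg \<omega> (Suc n))" by (simp add: B_def D_def)
    then have "\<exists>\<^sub>F k in sequentially. T n k (init_seg \<omega> n)"
      by (rule frequently_mono[rotated]) (auto simp: T_def init_seg_Suc forecast_seg_snoc)
    then show "\<omega> \<in> B n" by (simp add: B_def D_def)
  qed
  then have "decseq B" by (rule decseq_SucI)
  then have "emeasure (forecast_measure \<psi>) (\<Inter>n. B n) = (INF n. emeasure (forecast_measure \<psi>) (B n))"
    using B_sets by (intro INF_emeasure_decseq[symmetric]) auto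
  also have "c \<le> \<dots>" using D_large by (intro INF_greatest) (simp add: B_def)
  finally have "c \<le> emeasure (forecast_measure \<psi>) (\<Inter>n. B n)" .
  also have "\<dots> = outer_measure_of (forecast_measure \<psi>) (\<Inter>n. B n)"
    using B_sets by (intro outer_measure_of_eq[symmetric]) auto
  also have "\<dots> \<le> outer_measure_of (forecast_measure \<psi>) {\<omega>. forecast_path \<psi> \<omega> \<in> range f}"
  proof (intro outer_measure_of_mono subsetI CollectI)
    fix \<omega> assume \<omega>: "\<omega> \<in> (\<Inter>n. B n)"
    have "\<forall>n. \<exists>k a. n \<le> k \<and> a \<in> A (r k) \<and> init_seg (f a) n = init_seg (forecast_path (\<phi> k) \<omega>) n"
    proof
      fix n
      have "\<exists>\<^sub>F k in sequentially. T n k (init_seg \<omega> n)" using \<omega> by (simp add: B_def D_def)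
      then obtain k where "n \<le> k" "T n k (init_seg \<omega> n)"
        unfolding frequently_sequentially by blast
      then show "\<exists>k a. n \<le> k \<and> a \<in> A (r k) \<and> init_seg (f a) n = init_seg (forecast_path (\<phi> k) \<omega>) n"
        unfolding T_def init_seg_forecast_path by blast
    qed
    from choice[OF this] obtain k where "\<forall>n. \<exists>a. n \<le> k n \<and> a \<in> A (r (k n))
        \<and> init_seg (f a) n = init_seg (forecast_path (\<phi> (k n)) \<omega>) n" ..
    from choice[OF this] obtain a where k: "\<And>n. n \<le> k n" and a: "\<And>n. a n \<in> A (r (k n))"
        and eq: "\<And>n. init_seg (f (a n)) n = init_seg (forecast_path (\<phi> (k n)) \<omega>) n"
      by blast
    have k_lim: "filterlim k sequentially sequentially"
      using k by (intro filterlim_at_top_mono[OF filterlim_ident]) auto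
    show "forecast_path \<psi> \<omega> \<in> range f"
    proof (rule limit_of_bounded_images[OF f])
      show "a n i \<le> m i" if "i < n" for n i
        using a[of n] that k[of n] rk[of "k n"] by (simp add: A_def)
      show "(\<lambda>n. f (a n) j) \<longlonglongrightarrow> forecast_path \<psi> \<omega> j" for j
      proof -
        have "(\<lambda>n. (\<phi> (k n) (init_seg \<omega> j), \<omega> j)) \<longlonglongrightarrow> forecast_path \<psi> \<omega> j"
          unfolding forecast_path_def
          by (intro tendsto_Pair tendsto_const filterlim_compose[OF lim k_lim])
        moreover have "\<forall>\<^sub>F n in sequentially. (\<phi> (k n) (init_seg \<omega> j), \<omega> j) = f (a n) j"
          using eventually_gt_at_top[of j]
        proof eventually_elim
          case (elim n)
          have "init_seg (f (a n)) n ! j = init_seg (forecast_path (\<phi> (k n)) \<omega>) n ! j"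
            using eq by simp
          with elim show ?case by (simp add: init_seg_def[of _ n] forecast_path_def)
        qed
        ultimately show ?thesis by (rule Lim_transform_eventually)
      qed
    qed
  qed
  finally show thesis using fs\<psi> by (intro that)
qed

text \<open>
  One inequality is Ville's, for every forecasting system separately. The other one compares with every \<open>c\<close>
  below the game value, so it is enough that such a \<open>c\<close> is attained by one system.
\<close>
theorem theorem1:
  fixes E :: "(nat \<Rightarrow> real \<times> bool) set"
  assumes "E \<subseteq> prequential_space"
    and "analytic_in prequential_topology E"
  shows "upper_game_prob E = upper_meas_prob E"
proof -
  let ?m = "\<lambda>\<phi>. outer_measure_of (forecast_measure \<phi>) {\<omega>. forecast_path \<phi> \<omega> \<in> E}"
  have "enn2ereal (game_value E) = (SUP \<phi>\<in>{\<phi>. forecasting_system \<phi>}. enn2ereal (?m \<phi>))"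
  proof (rule antisym)
    show "(SUP \<phi>\<in>{\<phi>. forecasting_system \<phi>}. enn2ereal (?m \<phi>)) \<le> enn2ereal (game_value E)"
      using outer_measure_le_game by (intro SUP_least) (simp flip: less_eq_ennreal.rep_eq)
    have "game_value E \<le> (SUP \<phi>\<in>{\<phi>. forecasting_system \<phi>}. ?m \<phi>)"
    proof (rule dense_le)
      fix c assume c: "c < game_value E"
      then have "E \<noteq> {}" by auto
      then obtain f :: "(nat \<Rightarrow> nat) \<Rightarrow> nat \<Rightarrow> real \<times> bool"
        where f: "continuous_map euclidean prequential_topology f" "range f = E"
        using assms(2) unfolding analytic_in_def by blast
      obtain \<psi> where "forecasting_system \<psi>" "c \<le> ?m \<psi>"
        using game_analytic_attained[of f c] continuous_coordinate[OF f(1)] c f(2) by blast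
      then show "c \<le> (SUP \<phi>\<in>{\<phi>. forecasting_system \<phi>}. ?m \<phi>)"
        by (intro SUP_upper2[of \<psi>]) auto
    qed
    also have "(SUP \<phi>\<in>{\<phi>. forecasting_system \<phi>}. ?m \<phi>)
        \<le> e2ennreal (SUP \<phi>\<in>{\<phi>. forecasting_system \<phi>}. enn2ereal (?m \<phi>))"
    proof (rule SUP_least)
      fix \<phi> assume "\<phi> \<in> {\<phi>. forecasting_system \<phi>}"
      then have "enn2ereal (?m \<phi>) \<le> (SUP \<phi>\<in>{\<phi>. forecasting_system \<phi>}. enn2ereal (?m \<phi>))"
        by (rule SUP_upper)
      from e2ennreal_mono[OF this]
      show "?m \<phi> \<le> e2ennreal (SUP \<phi>\<in>{\<phi>. forecasting_system \<phi>}. enn2ereal (?m \<phi>))" by simp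
    qed
    finally have "game_value E \<le> e2ennreal (SUP \<phi>\<in>{\<phi>. forecasting_system \<phi>}. enn2ereal (?m \<phi>))" .
    moreover have "0 \<le> (SUP \<phi>\<in>{\<phi>. forecasting_system \<phi>}. enn2ereal (?m \<phi>))"
      by (rule SUP_upper2[of "\<lambda>_. 0"]) (auto simp: forecasting_system_def)
    ultimately show "enn2ereal (game_value E) \<le> (SUP \<phi>\<in>{\<phi>. forecasting_system \<phi>}. enn2ereal (?m \<phi>))"
      by (simp add: less_eq_ennreal.rep_eq enn2ereal_e2ennreal)
  qed
  then show ?thesis
    by (simp add: upper_game_prob_eq_game[OF assms(1)] upper_meas_prob_def)
qed

end
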